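(* Let $\mathbb{S}=(S,+,\star)$ be a (finite) presemifield of characteristic $p$, let $\mathbb{V}=\mathrm{End}_{\mathbb{F}_p}(S)$ and let $\mathcal{C}\subset\mathbb{V}$ be the spread set of $\mathbb{F}_p$-linear maps associated with $\mathbb{S}$. Then: (a) the right nucleus of each semifield isotopic to $\mathbb{S}$ is isomorphic to the largest field $\mathcal{N}_r(\mathbb{S})$ contained in $\mathbb{V}$ such that $\mathcal{N}_r(\mathbb{S})\,\mathcal{C}\subseteq\mathcal{C}$; (b) the middle nucleus of each semifield isotopic to $\mathbb{S}$ is isomorphic to the largest field $\mathcal{N}_m(\mathbb{S})$ contained in $\mathbb{V}$ such that $\mathcal{C}\,\mathcal{N}_m(\mathbb{S})\subseteq\mathcal{C}$; (c) the left nucleus of each semifield isotopic to $\mathbb{S}$ is isomorphic to the largest field $\mathcal{N}_l(\mathbb{S})$ contained in $\mathbb{V}$ such that $\mathcal{N}_l(\mathbb{S})\,\mathcal{C}^d\subseteq\mathcal{C}^d$, where $\mathcal{C}^d$ is the spread set associated with the dual presemifield $\mathbb{S}^d$ of $\mathbb{S}$; (d) the center of each semifield isotopic to $\mathbb{S}$ is isomorphic to the largest field $\mathcal{K}_{r,\omega}(\mathbb{S})$ contained in $\mathcal{N}_r(\mathbb{S})$ such that $$\rho\circ\varphi=\varphi\circ(\omega^{-1}\circ\rho\circ\omega)$$ for all $\rho\in\mathcal{K}_{r,\omega}(\mathbb{S})$ and $\varphi\in\mathcal{C}$, where $\omega$ is a fixed invertible element of $\mathcal{C}$. Equivalently, the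 center of each semifield isotopic to $\mathbb{S}$ is isomorphic to the largest field $\mathcal{K}_{m,\sigma}(\mathbb{S})$ contained in $\mathcal{N}_m(\mathbb{S})$ such that $$\varphi\circ\rho=(\sigma\circ\rho\circ\sigma^{-1})\circ\varphi$$ for all $\rho\in\mathcal{K}_{m,\sigma}(\mathbb{S})$ and $\varphi\in\mathcal{C}$, where $\sigma$ is a fixed invertible element of $\mathcal{C}$. Also, $\mathcal{K}_{m,\sigma}(\mathbb{S})$ and $\mathcal{K}_{r,\omega}(\mathbb{S})$ are conjugated fields.
   Context: A finite semifield $(S,+,\star)$ is a finite algebraic structure satisfying all axioms of a skewfield except possibly associativity of multiplication; a presemifield satisfies all axioms of a semifield except possibly the existence of a multiplicative identity. The additive group of a presemifield is an elementary abelian $p$-group; $p$ is its characteristic. For a semifield, the left, middle and right nuclei are $\mathbb{N}_l=\{a:(a\star b)\star c=a\star(b\star c)\ \forall b,c\}$, $\mathbb{N}_m=\{b:(a\star b)\star c=a\star(b\star c)\ \forall a,c\}$, $\mathbb{N}_r=\{c:(a\star b)\star c=a\star(b\star c)\ \forall a,b\}$, and the center is $\mathbb{K}=\{a\in\mathbb{N}_l\cap\mathbb{N}_m\cap\mathbb{N}_r: a\star b=b\star a\ \forall b\}$; these are fields. Two presemifields $(S,+,\star)$, $(S',+,\star')$ of characteristic $p$ are isotopic if there are invertible $\mathbb{F}_p$-linear maps $g_1,g_2,g_3:S\to S'$ with $g_1(x)\star' g_2(y)=g_3(x\star y)$ for all $x,y\in S$. Every presemifield is isotopic to some semifield. The spread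 set of $\mathbb{S}$ is $\mathcal{C}=\{\varphi_y: y\in S\}$ with $\varphi_y:x\in S\mapsto x\star y\in S$; it is an $\mathbb{F}_p$-subspace of $\mathbb{V}=\mathrm{End}_{\mathbb{F}_p}(S)$ all of whose nonzero elements are invertible. The dual presemifield is $\mathbb{S}^d=(S,+,\star^d)$ with $x\star^d y=y\star x$. A field contained in $\mathbb{V}$ is a subset that is a field under the addition and composition of maps. For subsets $A,B\subseteq\mathbb{V}$, $AB=\{\alpha\circ\beta:\alpha\in A,\beta\in B\}$. $\circ$ denotes composition of maps. *)

theory Defs
  imports "HOL-Algebra.Algebra"
begin

text \<open>
  Presemifields live on the ring records of \<open>HOL-Algebra\<close>; the field \<open>one\<close> carries no
  information for a presemifield.  A multiplication need not have an identity, so the skewfield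
  axiom on inverses of nonzero elements is rendered, as is standard for finite semifields, by the
  absence of zero divisors.  By finiteness this is the unique solvability of \<open>a \<otimes> x = b\<close> and
  \<open>x \<otimes> a = b\<close> for \<open>a \<noteq> \<zero>\<close>; see \<open>bij_left_mult\<close> and \<open>bij_right_mult\<close>.
\<close>

locale presemifield = abelian_group S for S (structure) +
  assumes finite_carrier: "finite (carrier S)"
    and nontrivial: "carrier S \<noteq> {\<zero>}"
    and mult_closed: "\<lbrakk>x \<in> carrier S; y \<in> carrier S\<rbrakk> \<Longrightarrow> x \<otimes> y \<in> carrier S"
    and left_distrib: "\<lbrakk>x \<in> carrier S; y \<in> carrier S; z \<in> carrier S\<rbrakk>
      \<Longrightarrow> (x \<oplus> y) \<otimes> z = (x \<otimes> z) \<oplus> (y \<otimes> z)"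
    and right_distrib: "\<lbrakk>x \<in> carrier S; y \<in> carrier S; z \<in> carrier S\<rbrakk>
      \<Longrightarrow> z \<otimes> (x \<oplus> y) = (z \<otimes> x) \<oplus> (z \<otimes> y)"
    and no_zero_divisors: "\<lbrakk>x \<in> carrier S; y \<in> carrier S; x \<otimes> y = \<zero>\<rbrakk> \<Longrightarrow> x = \<zero> \<or> y = \<zero>"

locale semifield = presemifield S for S (structure) +
  assumes one_in_carrier: "\<one> \<in> carrier S"
    and left_one: "x \<in> carrier S \<Longrightarrow> \<one> \<otimes> x = x"
    and right_one: "x \<in> carrier S \<Longrightarrow> x \<otimes> \<one> = x"

lemma (in presemifield) bij_left_mult:
  assumes a: "a \<in> carrier S" "a \<noteq> \<zero>"
  shows "bij_betw (\<lambda>x. a \<otimes> x) (carrier S) (carrier S)"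
proof -
  have "x = y" if x: "x \<in> carrier S" and y: "y \<in> carrier S" and e: "a \<otimes> x = a \<otimes> y" for x y
  proof -
    have d: "x \<ominus> y \<in> carrier S" using x y by simp
    have s: "(x \<ominus> y) \<oplus> y = x"
      using x y by (simp add: a_minus_def a_assoc l_neg)
    have "a \<otimes> (x \<ominus> y) \<oplus> a \<otimes> y = a \<otimes> x"
      using right_distrib[OF d y a(1)] s by simp
    also have "\<dots> = \<zero> \<oplus> a \<otimes> y" using e a y mult_closed by simp
    finally have "a \<otimes> (x \<ominus> y) = \<zero>"
      using a d y mult_closed add.r_cancel by (metis zero_closed)
    then have "x \<ominus> y = \<zero>" using no_zero_divisors a d by blast
    with s y show "x = y" by simp
  qed
  then have "inj_on (\<lambda>x. a \<otimes> x) (carrier S)" by (auto intro: inj_onI)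
  moreover have "(\<lambda>x. a \<otimes> x) ` carrier S \<subseteq> carrier S" using a mult_closed by auto
  ultimately show ?thesis
    using finite_carrier by (simp add: bij_betw_def endo_inj_surj)
qed

definition dual :: "('a, 'm) ring_scheme \<Rightarrow> ('a, 'm) ring_scheme" where
  "dual S = S\<lparr>monoid.mult := \<lambda>x y. y \<otimes>\<^bsub>S\<^esub> x\<rparr>"

lemma (in presemifield) presemifield_dual: "presemifield (dual S)"
proof -
  have "abelian_group (dual S)"
  proof (rule abelian_groupI)
    show "\<exists>y\<in>carrier (dual S). y \<oplus>\<^bsub>dual S\<^esub> x = \<zero>\<^bsub>dual S\<^esub>"
      if "x \<in> carrier (dual S)" for x
      using that l_neg a_inv_closed by (auto simp: dual_def)
  qed (auto simp: dual_def a_assoc intro: a_comm)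
  then show ?thesis
    unfolding dual_def
    by (intro presemifield.intro presemifield_axioms.intro)
       (use finite_carrier nontrivial mult_closed left_distrib right_distrib in
          \<open>auto dest: no_zero_divisors\<close>)
qed

lemma (in presemifield) bij_right_mult:
  assumes "a \<in> carrier S" "a \<noteq> \<zero>"
  shows "bij_betw (\<lambda>x. x \<otimes> a) (carrier S) (carrier S)"
  using presemifield.bij_left_mult[OF presemifield_dual, of a] assms by (simp add: dual_def)

text \<open>The additive group is an elementary abelian \<open>p\<close>-group.\<close>

definition has_characteristic :: "('a, 'm) ring_scheme \<Rightarrow> nat \<Rightarrow> bool" where
  "has_characteristic S p \<longleftrightarrow> Factorial_Ring.prime p \<and> (\<forall>x\<in>carrier S. [p] \<cdot>\<^bsub>S\<^esub> x = \<zero>\<^bsub>S\<^esub>)"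

definition left_nucleus :: "('a, 'm) ring_scheme \<Rightarrow> 'a set" where
  "left_nucleus S = {a \<in> carrier S. \<forall>b\<in>carrier S. \<forall>c\<in>carrier S.
     (a \<otimes>\<^bsub>S\<^esub> b) \<otimes>\<^bsub>S\<^esub> c = a \<otimes>\<^bsub>S\<^esub> (b \<otimes>\<^bsub>S\<^esub> c)}"

definition middle_nucleus :: "('a, 'm) ring_scheme \<Rightarrow> 'a set" where
  "middle_nucleus S = {b \<in> carrier S. \<forall>a\<in>carrier S. \<forall>c\<in>carrier S.
     (a \<otimes>\<^bsub>S\<^esub> b) \<otimes>\<^bsub>S\<^esub> c = a \<otimes>\<^bsub>S\<^esub> (b \<otimes>\<^bsub>S\<^esub> c)}"

definition right_nucleus :: "('a, 'm) ring_scheme \<Rightarrow> 'a set" where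
  "right_nucleus S = {c \<in> carrier S. \<forall>a\<in>carrier S. \<forall>b\<in>carrier S.
     (a \<otimes>\<^bsub>S\<^esub> b) \<otimes>\<^bsub>S\<^esub> c = a \<otimes>\<^bsub>S\<^esub> (b \<otimes>\<^bsub>S\<^esub> c)}"

definition semifield_center :: "('a, 'm) ring_scheme \<Rightarrow> 'a set" where
  "semifield_center S = {a \<in> left_nucleus S \<inter> middle_nucleus S \<inter> right_nucleus S.
     \<forall>b\<in>carrier S. a \<otimes>\<^bsub>S\<^esub> b = b \<otimes>\<^bsub>S\<^esub> a}"

text \<open>
  The scalars of the prime field are represented by \<open>k < p\<close>, acting by \<open>x \<mapsto> [k] \<cdot> x\<close>.
\<close>

definition Fp_linear ::
    "nat \<Rightarrow> ('a, 'm) ring_scheme \<Rightarrow> ('b, 'n) ring_scheme \<Rightarrow> ('a \<Rightarrow> 'b) \<Rightarrow> bool" where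
  "Fp_linear p S T f \<longleftrightarrow> f \<in> carrier S \<rightarrow> carrier T \<and>
     (\<forall>x\<in>carrier S. \<forall>y\<in>carrier S. f (x \<oplus>\<^bsub>S\<^esub> y) = f x \<oplus>\<^bsub>T\<^esub> f y) \<and>
     (\<forall>k<p. \<forall>x\<in>carrier S. f ([k] \<cdot>\<^bsub>S\<^esub> x) = [k] \<cdot>\<^bsub>T\<^esub> f x)"

definition isotopic ::
    "nat \<Rightarrow> ('a, 'm) ring_scheme \<Rightarrow> ('b, 'n) ring_scheme \<Rightarrow> bool" where
  "isotopic p S T \<longleftrightarrow> has_characteristic S p \<and> has_characteristic T p \<and>
     (\<exists>g1 g2 g3.
        (\<forall>g\<in>{g1, g2, g3}. Fp_linear p S T g \<and> bij_betw g (carrier S) (carrier T)) \<and>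
        (\<forall>x\<in>carrier S. \<forall>y\<in>carrier S. g1 x \<otimes>\<^bsub>T\<^esub> g2 y = g3 (x \<otimes>\<^bsub>S\<^esub> y)))"

text \<open>
  The endomorphism ring of the vector space underlying \<open>S\<close>, independent of the multiplication.
  Its elements are functions on the carrier, made \<open>extensional\<close> so that equality of maps is
  equality on the carrier.
\<close>

definition Fp_End :: "nat \<Rightarrow> ('a, 'm) ring_scheme \<Rightarrow> ('a \<Rightarrow> 'a) ring" where
  "Fp_End p S = \<lparr>
     carrier = {f \<in> extensional (carrier S). Fp_linear p S S f},
     monoid.mult = \<lambda>f g. compose (carrier S) f g,
     monoid.one = \<lambda>x\<in>carrier S. x,
     ring.zero = \<lambda>x\<in>carrier S. \<zero>\<^bsub>S\<^esub>,
     ring.add = \<lambda>f g. \<lambda>x\<in>carrier S. f x \<oplus>\<^bsub>S\<^esub> g x\<rparr>"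

definition spread_set :: "('a, 'm) ring_scheme \<Rightarrow> ('a \<Rightarrow> 'a) set" where
  "spread_set S = (\<lambda>y. \<lambda>x\<in>carrier S. x \<otimes>\<^bsub>S\<^esub> y) ` carrier S"

text \<open>
  The neutral elements of \<open>F\<close> are not required to be those of \<open>V\<close>, so this is weaker than
  \<open>subfield F V\<close>.
\<close>

definition field_contained_in :: "('c, 'm) ring_scheme \<Rightarrow> 'c set \<Rightarrow> bool" where
  "field_contained_in V F \<longleftrightarrow>
     F \<subseteq> carrier V \<and> (\<exists>z e. field (V\<lparr>carrier := F, ring.zero := z, monoid.one := e\<rparr>))"

text \<open>
  For a property \<open>P\<close> of sets, \<open>GREATEST F. P F\<close> is the set with that property
  containing all the others; it is only meaningful where such a set exists, which
  \<open>is_largest\<close> asserts.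
\<close>

definition is_largest :: "('c set \<Rightarrow> bool) \<Rightarrow> 'c set \<Rightarrow> bool" where
  "is_largest P N \<longleftrightarrow> P N \<and> (\<forall>F. P F \<longrightarrow> F \<subseteq> N)"

definition Nr_cond :: "nat \<Rightarrow> ('a, 'm) ring_scheme \<Rightarrow> ('a \<Rightarrow> 'a) set \<Rightarrow> bool" where
  "Nr_cond p S F \<longleftrightarrow> field_contained_in (Fp_End p S) F \<and>
     F <#>\<^bsub>Fp_End p S\<^esub> spread_set S \<subseteq> spread_set S"

definition Nm_cond :: "nat \<Rightarrow> ('a, 'm) ring_scheme \<Rightarrow> ('a \<Rightarrow> 'a) set \<Rightarrow> bool" where
  "Nm_cond p S F \<longleftrightarrow> field_contained_in (Fp_End p S) F \<and>
     spread_set S <#>\<^bsub>Fp_End p S\<^esub> F \<subseteq> spread_set S"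

definition Nl_cond :: "nat \<Rightarrow> ('a, 'm) ring_scheme \<Rightarrow> ('a \<Rightarrow> 'a) set \<Rightarrow> bool" where
  "Nl_cond p S F \<longleftrightarrow> field_contained_in (Fp_End p S) F \<and>
     F <#>\<^bsub>Fp_End p S\<^esub> spread_set (dual S) \<subseteq> spread_set (dual S)"

definition Nr :: "nat \<Rightarrow> ('a, 'm) ring_scheme \<Rightarrow> ('a \<Rightarrow> 'a) set" where
  "Nr p S = (GREATEST F. Nr_cond p S F)"

definition Nm :: "nat \<Rightarrow> ('a, 'm) ring_scheme \<Rightarrow> ('a \<Rightarrow> 'a) set" where
  "Nm p S = (GREATEST F. Nm_cond p S F)"

definition Nl :: "nat \<Rightarrow> ('a, 'm) ring_scheme \<Rightarrow> ('a \<Rightarrow> 'a) set" where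
  "Nl p S = (GREATEST F. Nl_cond p S F)"

definition Kr_cond ::
    "nat \<Rightarrow> ('a, 'm) ring_scheme \<Rightarrow> ('a \<Rightarrow> 'a) \<Rightarrow> ('a \<Rightarrow> 'a) set \<Rightarrow> bool" where
  "Kr_cond p S \<omega> F \<longleftrightarrow> field_contained_in (Fp_End p S) F \<and> F \<subseteq> Nr p S \<and>
     (\<forall>\<rho>\<in>F. \<forall>\<phi>\<in>spread_set S.
        \<rho> \<otimes>\<^bsub>Fp_End p S\<^esub> \<phi> =
        \<phi> \<otimes>\<^bsub>Fp_End p S\<^esub> (inv\<^bsub>Fp_End p S\<^esub> \<omega> \<otimes>\<^bsub>Fp_End p S\<^esub> \<rho> \<otimes>\<^bsub>Fp_End p S\<^esub> \<omega>))"

definition Km_cond ::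
    "nat \<Rightarrow> ('a, 'm) ring_scheme \<Rightarrow> ('a \<Rightarrow> 'a) \<Rightarrow> ('a \<Rightarrow> 'a) set \<Rightarrow> bool" where
  "Km_cond p S \<sigma> F \<longleftrightarrow> field_contained_in (Fp_End p S) F \<and> F \<subseteq> Nm p S \<and>
     (\<forall>\<rho>\<in>F. \<forall>\<phi>\<in>spread_set S.
        \<phi> \<otimes>\<^bsub>Fp_End p S\<^esub> \<rho> =
        (\<sigma> \<otimes>\<^bsub>Fp_End p S\<^esub> \<rho> \<otimes>\<^bsub>Fp_End p S\<^esub> inv\<^bsub>Fp_End p S\<^esub> \<sigma>) \<otimes>\<^bsub>Fp_End p S\<^esub> \<phi>)"

definition Kr :: "nat \<Rightarrow> ('a, 'm) ring_scheme \<Rightarrow> ('a \<Rightarrow> 'a) \<Rightarrow> ('a \<Rightarrow> 'a) set" where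
  "Kr p S \<omega> = (GREATEST F. Kr_cond p S \<omega> F)"

definition Km :: "nat \<Rightarrow> ('a, 'm) ring_scheme \<Rightarrow> ('a \<Rightarrow> 'a) \<Rightarrow> ('a \<Rightarrow> 'a) set" where
  "Km p S \<sigma> = (GREATEST F. Km_cond p S \<sigma> F)"

definition conjugated :: "('c, 'm) ring_scheme \<Rightarrow> 'c set \<Rightarrow> 'c set \<Rightarrow> bool" where
  "conjugated V A B \<longleftrightarrow> (\<exists>\<theta>\<in>Units V. B = (\<lambda>\<rho>. inv\<^bsub>V\<^esub> \<theta> \<otimes>\<^bsub>V\<^esub> \<rho> \<otimes>\<^bsub>V\<^esub> \<theta>) ` A)"

end

theory Submission
  imports "HOL-Computational_Algebra.Polynomial" Defs
begin

text \<open>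
  Everything takes place in the endomorphism ring \<open>V\<close> of the additive group of the presemifield
  \<open>S\<close>; linearity over the prime field is just additivity.  The spread set \<open>C\<close> is an additive
  subgroup of \<open>V\<close> whose nonzero elements are units.

  The maps \<open>f\<close> with \<open>f C \<subseteq> C\<close> form a subring, the left idealizer of \<open>C\<close>.  If \<open>f\<close> is nonzero and
  \<open>u \<in> C\<close> is a unit, then \<open>f u\<close> is a nonzero element of \<open>C\<close>, hence a unit, and so is \<open>f\<close>.  The left
  idealizer is thus a finite division ring, and Wedderburn's little theorem (\<open>wedderburn_little\<close>)
  makes it a field.  As it consists of all admissible maps, it is the largest field that part (a)
  asks for.  In the same way the right idealizer answers part (b), and the elements of either
  idealizer satisfying the twisted commutation rule answer part (d); part (c) is part (a) for
  the dual presemifield.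

  Wedderburn's theorem is proved by Witt's argument.  If the center has \<open>q\<close> elements and the ring
  \<open>q ^ n\<close> with \<open>n \<ge> 2\<close>, the value at \<open>q\<close> of the \<open>n\<close>-th cyclotomic polynomial is an integer that
  divides \<open>q ^ n - 1\<close> and the size of every conjugacy class outside the center, hence also
  \<open>q - 1\<close>; but its absolute value exceeds \<open>q - 1\<close> (\<open>cyclotomic_value\<close>).

  For a semifield \<open>T\<close> isotopic to \<open>S\<close> via \<open>(g1, g2, g3)\<close>, the right multiplications of \<open>T\<close> are carried
  to \<open>V\<close> along \<open>g3\<close>.  The isotopism relation says that the resulting set \<open>D\<close> is a translate \<open>C h\<close> with
  \<open>h = g1\<^sup>-\<^sup>1 g3\<close> invertible (\<open>isotopic_coordinates\<close>).  Since \<open>T\<close> has an identity, \<open>D\<close> contains the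
  identity map.  So an idealizer of \<open>D\<close> lies in \<open>D\<close>, and evaluation at the identity of \<open>T\<close> shows that
  it consists of the multiplications by the elements of a nucleus (\<open>coord_mult_mem\<close>).  The map from
  elements to multiplications reverses products, which is harmless because the image is
  commutative.  Translating \<open>C\<close> by \<open>h\<close> leaves the left idealizer alone and conjugates the right one
  by \<open>h\<close>.

  The twisted commutation rule depends neither on the chosen element of \<open>C\<close> nor, if that element
  is translated along with \<open>C\<close>, on \<open>h\<close>.  For \<open>D\<close> and the identity map it says that \<open>f\<close> commutes
  with \<open>D\<close>, which describes the center of \<open>T\<close>.  Conjugation by \<open>\<sigma>\<close> exchanges the left and
  the right version of the rule.
\<close>

section \<open>Values of cyclotomic polynomials\<close>

definition primitive_roots :: "nat \<Rightarrow> complex set" where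
  "primitive_roots n = {z. z ^ n = 1 \<and> (\<forall>k. 0 < k \<and> k < n \<longrightarrow> z ^ k \<noteq> 1)}"

definition cyclotomic :: "nat \<Rightarrow> complex poly" where
  "cyclotomic n = (\<Prod>z\<in>primitive_roots n. [:-z, 1:])"

lemma finite_primitive_roots: "0 < n \<Longrightarrow> finite (primitive_roots n)"
  by (rule finite_subset[OF _ finite_roots_unity[of n]]) (auto simp: primitive_roots_def)

lemma roots_unity_eq_UN_primitive:
  assumes "0 < n"
  shows "{z. z ^ n = 1} = (\<Union>d\<in>{d. d dvd n}. primitive_roots d)"
proof (intro equalityI subsetI)
  fix z :: complex assume z: "z \<in> {z. z ^ n = 1}"
  \<comment> \<open>The order of \<open>z\<close>; it divides \<open>n\<close> because \<open>z ^ (n mod d) = 1\<close>.\<close>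
  define d where "d = (LEAST k. 0 < k \<and> z ^ k = 1)"
  have d: "0 < d \<and> z ^ d = 1"
    unfolding d_def by (rule LeastI[of _ n]) (use z assms in auto)
  have min: "d \<le> k" if "0 < k" "z ^ k = 1" for k
    unfolding d_def by (rule Least_le) (use that in auto)
  have "z ^ n = (z ^ d) ^ (n div d) * z ^ (n mod d)"
    by (metis mult_div_mod_eq power_add power_mult)
  then have "z ^ (n mod d) = 1" using z d by simp
  moreover have "n mod d < d" using d by simp
  ultimately have "n mod d = 0" using min[of "n mod d"] by linarith
  then have "d dvd n" by (simp add: dvd_eq_mod_eq_0)
  moreover have "z \<in> primitive_roots d"
    unfolding primitive_roots_def using d min by (auto dest: leD)
  ultimately show "z \<in> (\<Union>d\<in>{d. d dvd n}. primitive_roots d)" by blast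
qed (auto simp: primitive_roots_def power_mult elim!: dvdE)

lemma primitive_roots_disjoint:
  assumes "0 < d" "0 < e" "d \<noteq> e"
  shows "primitive_roots d \<inter> primitive_roots e = {}"
  using assms unfolding primitive_roots_def by (auto simp: neq_iff)

lemma prod_roots_unity:
  assumes "0 < n"
  shows "(\<Prod>z\<in>{z::complex. z ^ n = 1}. [:-z, 1:]) = Polynomial.monom 1 n - 1"
    (is "?P = ?Q")
proof -
  have fin: "finite {z::complex. z ^ n = 1}" using finite_roots_unity[of n] assms by simp
  have degP: "Polynomial.degree ?P = n"
    by (simp add: degree_prod_sum_eq card_roots_unity_eq[OF assms])
  have degQ: "Polynomial.degree ?Q = n"
    using assms degree_add_eq_left[of "- 1" "Polynomial.monom (1::complex) n"]
    by (simp add: degree_monom_eq)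
  have lcP: "Polynomial.lead_coeff ?P = 1" by (simp add: lead_coeff_prod)
  have lcQ: "Polynomial.lead_coeff ?Q = 1" unfolding degQ using assms by simp
  show ?thesis
  proof (rule poly_eqI_degree_lead_coeff[where A = "{z. z ^ n = 1}" and n = n])
    fix z :: complex assume z: "z \<in> {z. z ^ n = 1}"
    have "poly ?P z = 0"
      unfolding poly_prod by (rule prod_zero[OF fin]) (rule bexI[OF _ z], simp)
    also have "\<dots> = poly ?Q z" using z by (simp add: poly_monom)
    finally show "poly ?P z = poly ?Q z" .
  next
    show "Polynomial.coeff ?P n = Polynomial.coeff ?Q n"
      using lcP lcQ unfolding degP degQ by simp
    show "n \<le> card {z::complex. z ^ n = 1}"
      by (simp only: card_roots_unity_eq[OF assms] order_refl)
    show "Polynomial.degree ?P \<le> n" "Polynomial.degree ?Q \<le> n"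
      by (simp_all only: degP degQ order_refl)
  qed
qed

text \<open>
  Every \<open>n\<close>-th root of unity is a primitive \<open>d\<close>-th root of unity for exactly one divisor \<open>d\<close> of \<open>n\<close>.
\<close>

lemma prod_cyclotomic:
  assumes "0 < n"
  shows "(\<Prod>d\<in>{d. d dvd n}. cyclotomic d) = Polynomial.monom 1 n - 1"
proof -
  have pos: "0 < d" if "d dvd n" for d using that assms dvd_pos_nat by blast
  have "Polynomial.monom 1 n - 1 = (\<Prod>z\<in>(\<Union>d\<in>{d. d dvd n}. primitive_roots d). [:-z, 1:])"
    by (simp only: prod_roots_unity[OF assms, symmetric] roots_unity_eq_UN_primitive[OF assms])
  also have "\<dots> = (\<Prod>d\<in>{d. d dvd n}. cyclotomic d)"
    unfolding cyclotomic_def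
  proof (rule prod.UNION_disjoint)
    show "finite {d. d dvd n}" using assms by simp
    show "\<forall>d\<in>{d. d dvd n}. finite (primitive_roots d)"
      using pos finite_primitive_roots by blast
    show "\<forall>d\<in>{d. d dvd n}. \<forall>e\<in>{d. d dvd n}. d \<noteq> e \<longrightarrow>
        primitive_roots d \<inter> primitive_roots e = {}"
      using pos primitive_roots_disjoint by blast
  qed
  finally show ?thesis ..
qed

definition integral_coeffs :: "complex poly \<Rightarrow> bool" where
  "integral_coeffs f \<longleftrightarrow> (\<forall>i. Polynomial.coeff f i \<in> \<int>)"

lemma integral_coeffs_mult: "integral_coeffs f \<Longrightarrow> integral_coeffs g \<Longrightarrow> integral_coeffs (f * g)"
  unfolding integral_coeffs_def by (auto simp: coeff_mult intro!: Ints_mult)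

lemma integral_coeffs_prod:
  "(\<And>i. i \<in> I \<Longrightarrow> integral_coeffs (f i)) \<Longrightarrow> integral_coeffs (prod f I)"
  by (induction I rule: infinite_finite_induct)
     (auto intro: integral_coeffs_mult simp: integral_coeffs_def[of 1] of_bool_def)

lemma integral_coeffs_diff: "integral_coeffs f \<Longrightarrow> integral_coeffs g \<Longrightarrow> integral_coeffs (f - g)"
  unfolding integral_coeffs_def by (auto intro!: Ints_diff)

lemma integral_coeffs_poly: "integral_coeffs f \<Longrightarrow> x \<in> \<int> \<Longrightarrow> poly f x \<in> \<int>"
  unfolding integral_coeffs_def poly_altdef by (auto intro!: Ints_mult Ints_power)

text \<open>
  Division by a monic polynomial needs no denominators: comparing the coefficients of \<open>f * g\<close> in
  degree \<open>i + degree g\<close> expresses the \<open>i\<close>-th coefficient of \<open>f\<close> by those of higher degree.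
\<close>

lemma integral_coeffs_cofactor:
  assumes "integral_coeffs (f * g)" "integral_coeffs g" "Polynomial.lead_coeff g = 1"
  shows "integral_coeffs f"
proof -
  let ?m = "Polynomial.degree g"
  have "Polynomial.coeff f i \<in> \<int>" for i
  proof (induction "Polynomial.degree f - i" arbitrary: i rule: less_induct)
    case less
    show ?case
    proof (cases "i \<le> Polynomial.degree f")
      case False then show ?thesis by (simp add: coeff_eq_0)
    next
      case True
      have "Polynomial.coeff (f * g) (i + ?m)
          = (\<Sum>j\<le>i + ?m. Polynomial.coeff f j * Polynomial.coeff g (i + ?m - j))"
        by (simp add: coeff_mult)
      also have "\<dots> = Polynomial.coeff f i
          + (\<Sum>j\<in>{..i + ?m} - {i}. Polynomial.coeff f j * Polynomial.coeff g (i + ?m - j))"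
        using assms(3) by (subst sum.remove[of _ i]) auto
      finally have eq: "Polynomial.coeff f i = Polynomial.coeff (f * g) (i + ?m)
          - (\<Sum>j\<in>{..i + ?m} - {i}. Polynomial.coeff f j * Polynomial.coeff g (i + ?m - j))"
        by simp
      have "Polynomial.coeff f j * Polynomial.coeff g (i + ?m - j) \<in> \<int>"
        if j: "j \<in> {..i + ?m} - {i}" for j
      proof (cases "j < i")
        case True
        then have "Polynomial.coeff g (i + ?m - j) = 0" by (intro coeff_eq_0) auto
        then show ?thesis by simp
      next
        case False
        then have "i < j" using j by auto
        then have "Polynomial.coeff f j \<in> \<int>"
        proof (cases "j \<le> Polynomial.degree f")
          case True with \<open>i < j\<close> show ?thesis by (intro less) auto
        qed (simp add: coeff_eq_0)
        then show ?thesis using assms(2) by (auto simp: integral_coeffs_def intro: Ints_mult)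
      qed
      then show ?thesis
        unfolding eq using assms(1) by (intro Ints_diff Ints_sum) (auto simp: integral_coeffs_def)
    qed
  qed
  then show ?thesis by (simp add: integral_coeffs_def)
qed

lemma lead_coeff_cyclotomic: "Polynomial.lead_coeff (cyclotomic n) = 1"
  by (simp add: cyclotomic_def lead_coeff_prod)

text \<open>
  By induction, the product of the other cyclotomic factors of \<open>x ^ n - 1\<close> is monic and integral,
  so its cofactor is integral.
\<close>

lemma integral_coeffs_cyclotomic: "0 < n \<Longrightarrow> integral_coeffs (cyclotomic n)"
proof (induction n rule: less_induct)
  case (less n)
  let ?D = "{d. d dvd n} - {n}"
  have fin: "finite {d. d dvd n}" using less.prems by simp
  have eq: "cyclotomic n * (\<Prod>d\<in>?D. cyclotomic d) = Polynomial.monom 1 n - 1"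
    using prod_cyclotomic[OF less.prems] prod.remove[OF fin, of n cyclotomic] by simp
  have "integral_coeffs (Polynomial.monom 1 n - 1)"
    by (intro integral_coeffs_diff) (auto simp: integral_coeffs_def)
  moreover have "integral_coeffs (\<Prod>d\<in>?D. cyclotomic d)"
  proof (rule integral_coeffs_prod)
    fix d assume "d \<in> ?D"
    then have "d dvd n" "d \<noteq> n" by auto
    then have "d < n" "0 < d"
      using less.prems dvd_imp_le[of d n] dvd_pos_nat[of n d] by auto
    then show "integral_coeffs (cyclotomic d)" by (rule less.IH)
  qed
  moreover have "Polynomial.lead_coeff (\<Prod>d\<in>?D. cyclotomic d) = 1"
    by (simp add: lead_coeff_prod lead_coeff_cyclotomic del: )
  ultimately show ?case using eq integral_coeffs_cofactor by metis
qed

text \<open>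
  A root of unity \<open>z \<noteq> 1\<close> has real part less than 1, so each factor of the value has norm
  \<open>\<bar>q - z\<bar> \<ge> q - Re z > q - 1 \<ge> 1\<close>.  There is at least one factor, since \<open>cis (2 * pi / n)\<close> is a
  primitive root.
\<close>

lemma norm_cyclotomic_gt:
  assumes "2 \<le> n" "2 \<le> (q::nat)"
  shows "real q - 1 < norm (poly (cyclotomic n) (of_nat q))"
proof -
  let ?P = "primitive_roots n"
  have fin: "finite ?P" using finite_primitive_roots assms by simp
  have gt: "real q - 1 < norm (of_nat q - z)" if z: "z \<in> ?P" for z
  proof -
    have n1: "z ^ n = 1" and "z \<noteq> 1"
      using z assms(1) unfolding primitive_roots_def by (auto dest: spec[of _ 1])
    have "norm z = 1" using n1 assms(1) by (metis norm_one norm_power power_eq_1_iff norm_ge_zero not_numeral_le_zero)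
    have "Re z \<noteq> 1"
    proof
      assume "Re z = 1"
      with \<open>norm z = 1\<close> have "Im z = 0" by (simp add: cmod_def)
      with \<open>Re z = 1\<close> \<open>z \<noteq> 1\<close> show False by (simp add: complex_eq_iff)
    qed
    moreover have "Re z \<le> 1" using complex_Re_le_cmod[of z] \<open>norm z = 1\<close> by simp
    ultimately have "real q - 1 < Re (of_nat q - z)" by simp
    also have "\<dots> \<le> norm (of_nat q - z)" by (rule complex_Re_le_cmod)
    finally show ?thesis .
  qed
  have "cis (2 * pi * real 1 / real n) \<in> ?P"
  proof -
    have inj: "inj_on (\<lambda>k. cis (2 * pi * real k / real n)) {..<n}"
      using bij_betw_roots_unity[of n] assms(1) unfolding bij_betw_def by auto
    have pow: "cis (2 * pi * real 1 / real n) ^ n = 1"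
      using assms(1) by (simp add: DeMoivre)
    have "cis (2 * pi * real 1 / real n) ^ k \<noteq> 1" if "0 < k" "k < n" for k
    proof -
      have "cis (2 * pi * real 1 / real n) ^ k = cis (2 * pi * real k / real n)"
        by (simp add: DeMoivre mult_ac)
      also have "\<dots> \<noteq> cis (2 * pi * real 0 / real n)"
        using inj_onD[OF inj, of k 0] that by auto
      finally show ?thesis by simp
    qed
    with pow show ?thesis unfolding primitive_roots_def by blast
  qed
  then obtain z where z: "z \<in> ?P" by blast
  have ge_1: "1 \<le> norm (of_nat q - y)" if "y \<in> ?P - {z}" for y
  proof -
    have "1 \<le> real q - 1" using assms(2) by linarith
    then show ?thesis using gt[of y] that by auto
  qed
  have "real q - 1 < norm (of_nat q - z)" using gt z by blast
  also have "\<dots> = norm (of_nat q - z) * 1" by simp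
  also have "\<dots> \<le> norm (of_nat q - z) * (\<Prod>z\<in>?P - {z}. norm (of_nat q - z))"
    by (intro mult_left_mono prod_ge_1 ge_1 norm_ge_zero)
  also have "\<dots> = (\<Prod>z\<in>?P. norm (of_nat q - z))"
    using prod.remove[OF fin z, of "\<lambda>z. norm (of_nat q - z)"] by simp
  also have "\<dots> = norm (poly (cyclotomic n) (of_nat q))"
    unfolding cyclotomic_def by (simp add: poly_prod norm_minus_commute flip: prod_norm)
  finally show ?thesis .
qed

text \<open>
  The number \<open>m\<close> is the value of the \<open>n\<close>-th cyclotomic polynomial.  It divides the quotient of
  \<open>q ^ n - 1\<close> by \<open>q ^ d - 1\<close> because the cyclotomic factors of \<open>x ^ d - 1\<close> are among those of
  \<open>x ^ n - 1\<close> and do not include the \<open>n\<close>-th one.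
\<close>

lemma cyclotomic_value:
  assumes n: "2 \<le> n" and q: "2 \<le> (q::nat)"
  obtains m :: int where "m dvd int q ^ n - 1"
    and "\<And>d k. \<lbrakk>d dvd n; d < n; k * (int q ^ d - 1) = int q ^ n - 1\<rbrakk> \<Longrightarrow> m dvd k"
    and "int q - 1 < \<bar>m\<bar>"
proof -
  let ?v = "\<lambda>d. poly (cyclotomic d) (of_nat q)"
  have int: "?v d \<in> \<int>" if "0 < d" for d
    using that by (intro integral_coeffs_poly integral_coeffs_cyclotomic) auto
  obtain m where m: "?v n = of_int m" using int[of n] n by (auto elim: Ints_cases)
  have prod: "(\<Prod>d\<in>{d. d dvd e}. ?v d) = of_int (int q ^ e - 1)" if "0 < e" for e
    using prod_cyclotomic[OF that] by (simp add: poly_monom flip: poly_prod)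
  have fin: "finite {d. d dvd n}" using n by simp
  have intprod: "(\<Prod>d\<in>A. ?v d) \<in> \<int>" if "A \<subseteq> {d. d dvd n}" for A
  proof (intro Ints_prod int)
    fix d assume "d \<in> A"
    with that have "d dvd n" by blast
    then show "0 < d" using n dvd_pos_nat[of n d] by auto
  qed
  show thesis
  proof
    obtain r where r: "(\<Prod>d\<in>{d. d dvd n} - {n}. ?v d) = of_int r"
      using intprod[of "{d. d dvd n} - {n}"] by (auto elim: Ints_cases)
    have "of_int (int q ^ n - 1) = (of_int (m * r) :: complex)"
      using prod[of n] n prod.remove[OF fin, of n ?v] m r by simp
    then have "int q ^ n - 1 = m * r" by (simp only: of_int_eq_iff)
    then show "m dvd int q ^ n - 1" by simp
  next
    fix d and k :: int assume d: "d dvd n" "d < n" and k: "k * (int q ^ d - 1) = int q ^ n - 1"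
    have d0: "0 < d" using d n dvd_pos_nat[of n d] by auto
    have sub: "{e. e dvd d} \<subseteq> {e. e dvd n} - {n}"
    proof
      fix e assume e: "e \<in> {e. e dvd d}"
      then have "e \<le> d" using d0 by (auto intro: dvd_imp_le)
      then show "e \<in> {e. e dvd n} - {n}" using e d dvd_trans[of e d n] by auto
    qed
    let ?R = "({e. e dvd n} - {n}) - {e. e dvd d}"
    obtain r where r: "(\<Prod>e\<in>?R. ?v e) = of_int r"
      using intprod[of ?R] by (auto elim: Ints_cases)
    have "of_int (int q ^ n - 1) = ?v n * (\<Prod>e\<in>{e. e dvd n} - {n}. ?v e)"
      using prod[of n] n prod.remove[OF fin, of n ?v] by simp
    also have "(\<Prod>e\<in>{e. e dvd n} - {n}. ?v e) = (\<Prod>e\<in>?R. ?v e) * (\<Prod>e\<in>{e. e dvd d}. ?v e)"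
      using fin sub by (intro prod.subset_diff) auto
    also have "?v n * \<dots> = of_int (m * (r * (int q ^ d - 1)))"
      using prod[OF d0] m r by simp
    finally have "int q ^ n - 1 = m * r * (int q ^ d - 1)" by (simp only: of_int_eq_iff mult.assoc)
    moreover have "1 < int q ^ d" using q d0 by (intro one_less_power) auto
    ultimately have "k = m * r" using k by simp
    then show "m dvd k" by simp
  next
    have "real_of_int (int q - 1) < real_of_int \<bar>m\<bar>"
      using norm_cyclotomic_gt[OF n q] m by simp
    then show "int q - 1 < \<bar>m\<bar>" by (simp only: of_int_less_iff)
  qed
qed

section \<open>Wedderburn's little theorem\<close>

text \<open>
  A finite ring is a free left module over each of its division subrings, so the cardinality of
  a submodule is a power of that of the subring.  This replaces dimension theory below.
\<close>

locale division_subring = ring R for R (structure) +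
  fixes K
  assumes subring_K: "subring K R"
    and nonzero_invertible: "\<lbrakk>k \<in> K; k \<noteq> \<zero>\<rbrakk> \<Longrightarrow> \<exists>l\<in>K. l \<otimes> k = \<one>"
    and finite_ring: "finite (carrier R)"
    and one_not_zero: "\<one> \<noteq> \<zero>"
begin

definition left_submodule :: "'a set \<Rightarrow> bool" where
  "left_submodule B \<longleftrightarrow> B \<subseteq> carrier R \<and> \<zero> \<in> B \<and>
     (\<forall>a\<in>B. \<forall>b\<in>B. a \<oplus> b \<in> B) \<and> (\<forall>k\<in>K. \<forall>b\<in>B. k \<otimes> b \<in> B)"

lemma K_closed: "k \<in> K \<Longrightarrow> k \<in> carrier R"
  using subringE(1)[OF subring_K] by blast

lemma submodule_minus_closed:
  assumes "left_submodule B" "a \<in> B" "b \<in> B"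
  shows "a \<ominus> b \<in> B"
proof -
  have "b \<in> carrier R" using assms unfolding left_submodule_def by blast
  then have "\<ominus> b = (\<ominus> \<one>) \<otimes> b" by (simp add: l_minus)
  moreover have "\<ominus> \<one> \<in> K" using subringE(3,5)[OF subring_K] by blast
  ultimately show ?thesis
    using assms unfolding left_submodule_def a_minus_def by metis
qed

text \<open>
  The sum \<open>B + K v\<close> is direct: a relation \<open>k \<otimes> v \<in> B\<close> with \<open>k \<noteq> \<zero>\<close> would give \<open>v \<in> B\<close> after
  multiplication by an inverse of \<open>k\<close>.
\<close>

lemma enlarge_submodule:
  assumes B: "left_submodule B" and v: "v \<in> carrier R" "v \<notin> B"
  defines "B' \<equiv> (\<lambda>(b, k). b \<oplus> k \<otimes> v) ` (B \<times> K)"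
  shows "left_submodule B'" and "card B' = card K * card B" and "B \<subset> B'"
    and "\<And>A. \<lbrakk>left_submodule A; B \<subseteq> A; v \<in> A\<rbrakk> \<Longrightarrow> B' \<subseteq> A"
proof -
  have Bc: "b \<in> carrier R" if "b \<in> B" for b
    using B that unfolding left_submodule_def by blast
  have K0: "\<zero> \<in> K" and K1: "\<one> \<in> K" using subringE(2,3)[OF subring_K] by auto
  have mem: "b \<oplus> k \<otimes> v \<in> B'" if "b \<in> B" "k \<in> K" for b k
    unfolding B'_def using that by (auto intro!: image_eqI[of _ _ "(b, k)"])
  have "x \<in> B'" if "x \<in> B" for x
    using mem[OF that K0] that v Bc by simp
  moreover have "v \<in> B'"
    using mem[of \<zero> \<one>] K1 B v unfolding left_submodule_def by simp
  ultimately show sub: "B \<subset> B'" using v by blast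
  show "left_submodule B'"
    unfolding left_submodule_def
  proof (intro conjI ballI)
    show "B' \<subseteq> carrier R" unfolding B'_def using Bc K_closed v by auto
    show "\<zero> \<in> B'" using sub B unfolding left_submodule_def by blast
  next
    fix x y assume "x \<in> B'" "y \<in> B'"
    then obtain b k c l where x: "x = b \<oplus> k \<otimes> v" "b \<in> B" "k \<in> K"
      and y: "y = c \<oplus> l \<otimes> v" "c \<in> B" "l \<in> K"
      unfolding B'_def by auto
    have "x \<oplus> y = (b \<oplus> c) \<oplus> (k \<oplus> l) \<otimes> v"
      using x y v Bc K_closed by (simp add: l_distr a_ac)
    moreover have "b \<oplus> c \<in> B" using x y B unfolding left_submodule_def by blast
    moreover have "k \<oplus> l \<in> K" using x y subringE(7)[OF subring_K] by blast
    ultimately show "x \<oplus> y \<in> B'" using mem by simp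
  next
    fix k x assume k: "k \<in> K" and "x \<in> B'"
    then obtain c l where x: "x = c \<oplus> l \<otimes> v" "c \<in> B" "l \<in> K"
      unfolding B'_def by auto
    have "k \<otimes> x = k \<otimes> c \<oplus> (k \<otimes> l) \<otimes> v"
      using x k v Bc K_closed by (simp add: r_distr m_assoc)
    moreover have "k \<otimes> c \<in> B" using x k B unfolding left_submodule_def by blast
    moreover have "k \<otimes> l \<in> K" using x k subringE(6)[OF subring_K] by blast
    ultimately show "k \<otimes> x \<in> B'" using mem by simp
  qed
  have "inj_on (\<lambda>(b, k). b \<oplus> k \<otimes> v) (B \<times> K)"
  proof (rule inj_onI, clarsimp)
    fix b k c l assume bc: "b \<in> B" "c \<in> B" and kl: "k \<in> K" "l \<in> K"
      and eq: "b \<oplus> k \<otimes> v = c \<oplus> l \<otimes> v"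
    note cl = bc[THEN Bc] kl[THEN K_closed] v(1)
    have "(k \<ominus> l) \<otimes> v = k \<otimes> v \<ominus> l \<otimes> v"
      using cl by (simp add: a_minus_def l_distr l_minus)
    also have "\<dots> = \<ominus> b \<oplus> (b \<oplus> k \<otimes> v) \<ominus> l \<otimes> v"
      using cl by (simp add: a_assoc[symmetric] l_neg a_minus_def)
    also have "\<dots> = c \<ominus> b"
      unfolding eq using cl by (simp add: a_minus_def a_ac r_neg)
    finally have diff: "(k \<ominus> l) \<otimes> v = c \<ominus> b" .
    have "k = l"
    proof (rule ccontr)
      assume "k \<noteq> l"
      then have "k \<ominus> l \<noteq> \<zero>" using cl by (simp add: r_right_minus_eq)
      moreover have klK: "k \<ominus> l \<in> K"
        using kl subringE(5,7)[OF subring_K] unfolding a_minus_def by blast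
      ultimately obtain i where i: "i \<in> K" "i \<otimes> (k \<ominus> l) = \<one>"
        using nonzero_invertible by blast
      have "v = i \<otimes> (c \<ominus> b)"
        using i cl K_closed[OF klK] K_closed[OF i(1)] by (simp add: m_assoc[symmetric] flip: diff)
      also have "\<dots> \<in> B"
        using submodule_minus_closed[OF B bc(2,1)] i B unfolding left_submodule_def by blast
      finally show False using v by blast
    qed
    with eq cl show "b = c \<and> k = l" by simp
  qed
  then show "card B' = card K * card B"
    unfolding B'_def by (simp add: card_image card_cartesian_product)
  show "B' \<subseteq> A" if "left_submodule A" "B \<subseteq> A" "v \<in> A" for A
    using that unfolding B'_def left_submodule_def by auto
qed

text \<open>
  Adjoining elements of \<open>A\<close> one at a time to the zero submodule multiplies the cardinality by
  \<open>card K\<close> in each step, until \<open>A\<close> is exhausted.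
\<close>

lemma card_submodule:
  assumes A: "left_submodule A"
  shows "\<exists>n. card A = card K ^ n"
proof -
  have finA: "finite A"
    using A finite_ring finite_subset unfolding left_submodule_def by blast
  have "\<exists>n. card A = card K ^ n"
    if "left_submodule B" "B \<subseteq> A" "card B = card K ^ m" for B m
    using that
  proof (induction "card A - card B" arbitrary: B m rule: less_induct)
    case less
    show ?case
    proof (cases "B = A")
      case False
      then obtain v where v: "v \<in> A" "v \<notin> B" using less.prems by blast
      then have vc: "v \<in> carrier R" using A unfolding left_submodule_def by blast
      define B' where "B' = (\<lambda>(b, k). b \<oplus> k \<otimes> v) ` (B \<times> K)"
      note enl = enlarge_submodule[OF less.prems(1) vc v(2), folded B'_def]
      have B'A: "B' \<subseteq> A" using enl(4)[OF A less.prems(2) v(1)] .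
      have "card B < card B'"
        using enl(3) finite_subset[OF B'A finA] by (rule psubset_card_mono[rotated])
      moreover have "card B' \<le> card A" using B'A finA by (rule card_mono[rotated])
      ultimately have "card A - card B' < card A - card B" by linarith
      moreover have "card B' = card K ^ Suc m" using less.prems(3) enl(2) by simp
      ultimately show ?thesis using less.hyps enl(1) B'A by blast
    qed (use less in blast)
  qed
  moreover have "left_submodule {\<zero>}"
    unfolding left_submodule_def using K_closed by auto
  moreover have "card {\<zero>} = card K ^ 0" by simp
  moreover have "{\<zero>} \<subseteq> A" using A unfolding left_submodule_def by blast
  ultimately show ?thesis by blast
qed

lemma card_ge_2: "2 \<le> card K"
proof -
  have "finite K" using finite_subset[OF subringE(1)[OF subring_K] finite_ring] .
  then have "card {\<zero>, \<one>} \<le> card K"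
    using subringE(2,3)[OF subring_K] by (intro card_mono) auto
  then show ?thesis using one_not_zero by simp
qed

end

definition centralizer :: "('a, 'm) ring_scheme \<Rightarrow> 'a set \<Rightarrow> 'a set" where
  "centralizer R Y = {a \<in> carrier R. \<forall>x\<in>Y. a \<otimes>\<^bsub>R\<^esub> x = x \<otimes>\<^bsub>R\<^esub> a}"

lemma (in ring) centralizer_subring:
  assumes "Y \<subseteq> carrier R"
  shows "subring (centralizer R Y) R"
proof (rule subringI)
  have Y: "x \<in> carrier R" if "x \<in> Y" for x using that assms by blast
  show "centralizer R Y \<subseteq> carrier R" by (auto simp: centralizer_def)
  show "\<one> \<in> centralizer R Y" using Y by (simp add: centralizer_def)
  show "\<ominus> h \<in> centralizer R Y" if "h \<in> centralizer R Y" for h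
    using that Y by (simp add: centralizer_def l_minus r_minus)
  show "h1 \<oplus> h2 \<in> centralizer R Y" if "h1 \<in> centralizer R Y" "h2 \<in> centralizer R Y" for h1 h2
    using that Y by (simp add: centralizer_def l_distr r_distr)
  show "h1 \<otimes> h2 \<in> centralizer R Y" if "h1 \<in> centralizer R Y" "h2 \<in> centralizer R Y" for h1 h2
  proof -
    have "h1 \<otimes> h2 \<otimes> x = x \<otimes> (h1 \<otimes> h2)" if x: "x \<in> Y" for x
    proof -
      have "h1 \<otimes> h2 \<otimes> x = h1 \<otimes> (x \<otimes> h2)"
        using \<open>h1 \<in> _\<close> \<open>h2 \<in> _\<close> x Y[OF x] by (simp add: centralizer_def m_assoc)
      also have "\<dots> = x \<otimes> (h1 \<otimes> h2)"
        using \<open>h1 \<in> _\<close> \<open>h2 \<in> _\<close> x Y[OF x] by (simp add: centralizer_def flip: m_assoc)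
      finally show ?thesis .
    qed
    with that show ?thesis by (simp add: centralizer_def)
  qed
qed

lemma (in ring) centralizer_inv:
  assumes "Y \<subseteq> carrier R" and a: "a \<in> centralizer R Y" "a \<in> Units R"
  shows "inv a \<in> centralizer R Y"
proof -
  have "inv a \<otimes> x = x \<otimes> inv a" if x: "x \<in> Y" for x
  proof -
    have xc: "x \<in> carrier R" and ac: "a \<in> carrier R" and c: "a \<otimes> x = x \<otimes> a"
      using x assms by (auto simp: centralizer_def)
    have "inv a \<otimes> x = inv a \<otimes> (x \<otimes> a) \<otimes> inv a"
      using xc ac a(2) by (simp add: m_assoc)
    also have "\<dots> = inv a \<otimes> (a \<otimes> x) \<otimes> inv a" by (simp only: c)
    also have "\<dots> = x \<otimes> inv a" using xc ac a(2) by (simp flip: m_assoc)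
    finally show ?thesis .
  qed
  then show ?thesis using a by (simp add: centralizer_def)
qed

text \<open>
  Witt's proof.  The group of units acts on itself by conjugation; the class of a noncentral \<open>x\<close> has
  \<open>(q ^ n - 1) / (q ^ d - 1)\<close> elements, where \<open>q ^ d\<close> is the cardinality of the centralizer of \<open>x\<close>, and
  \<open>d\<close> divides \<open>n\<close> because the ring is free over that centralizer.
\<close>

theorem (in ring) wedderburn_little:
  assumes finite: "finite (carrier R)" and units: "Units R = carrier R - {\<zero>}"
  shows "field R"
proof -
  have one0: "\<one> \<noteq> \<zero>" using units Units_one_closed by auto
  define Z where "Z = centralizer R (carrier R)"
  have division: "division_subring R (centralizer R Y)" if Y: "Y \<subseteq> carrier R" for Y
  proof (intro division_subring.intro division_subring_axioms.intro ring_axioms)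
    show "subring (centralizer R Y) R" using centralizer_subring[OF Y] .
    fix k assume k: "k \<in> centralizer R Y" "k \<noteq> \<zero>"
    then have "k \<in> Units R" using units by (auto simp: centralizer_def)
    then show "\<exists>l\<in>centralizer R Y. l \<otimes> k = \<one>" using centralizer_inv[OF Y k(1)] Units_l_inv by blast
  qed (use finite one0 in auto)
  interpret Z: division_subring R Z using division[of "carrier R"] by (simp add: Z_def)
  have mod: "division_subring.left_submodule R K A" if "subring K R" "subring A R" "K \<subseteq> A"
    and "division_subring R K" for K A
    unfolding division_subring.left_submodule_def[OF that(4)]
    using subringE(1,2,6,7)[OF that(2)] that(3) by (intro conjI ballI) (blast, blast, blast, blast)
  define q where "q = card Z"
  have q2: "2 \<le> q" using Z.card_ge_2 by (simp add: q_def)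
  have Z_sub: "Z \<subseteq> centralizer R Y" if "Y \<subseteq> carrier R" for Y
    using that by (auto simp: Z_def centralizer_def)
  obtain n where n: "card (carrier R) = q ^ n"
    using Z.card_submodule[OF mod[OF Z.subring_K carrier_is_subring _ Z.division_subring_axioms]]
    subringE(1)[OF Z.subring_K] by (auto simp: q_def)
  have "Z = carrier R"
  proof (cases "2 \<le> n")
    case False
    have "card (carrier R) \<le> card Z"
    proof (cases "n = 0")
      case True
      then show ?thesis using n q2 by (simp add: q_def)
    next
      case False
      with \<open>\<not> 2 \<le> n\<close> have "n = 1" by simp
      then show ?thesis using n by (simp add: q_def)
    qed
    then show ?thesis using subringE(1)[OF Z.subring_K] finite by (intro card_seteq)
  next
    case True
    obtain m :: int where m: "m dvd int q ^ n - 1"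
      and mdvd: "\<And>d k. \<lbrakk>d dvd n; d < n; k * (int q ^ d - 1) = int q ^ n - 1\<rbrakk> \<Longrightarrow> m dvd k"
      and mgt: "int q - 1 < \<bar>m\<bar>"
      by (rule cyclotomic_value[OF True q2]) blast
    let ?G = "units_of R"
    interpret G: group ?G by (rule units_group)
    have carG: "carrier ?G = carrier R - {\<zero>}" by (simp add: units_of_carrier units)
    define act where "act = (\<lambda>g. \<lambda>h\<in>carrier ?G. g \<otimes>\<^bsub>?G\<^esub> h \<otimes>\<^bsub>?G\<^esub> inv\<^bsub>?G\<^esub> g)"
    interpret act: group_action ?G "carrier ?G" act
      unfolding act_def by (rule G.action_by_conjugation)
    have act_eq: "act g h = g \<otimes> h \<otimes> inv g" if "g \<in> Units R" "h \<in> Units R" for g h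
      using that by (simp add: act_def units_of_carrier units_of_mult units_of_inv)
    have fixed_iff: "act g h = h \<longleftrightarrow> g \<otimes> h = h \<otimes> g" if "g \<in> Units R" "h \<in> Units R" for g h
    proof
      assume "act g h = h"
      then have "g \<otimes> h \<otimes> inv g \<otimes> g = h \<otimes> g" using that by (simp add: act_eq)
      then show "g \<otimes> h = h \<otimes> g" using that by (simp add: m_assoc Units_closed)
    next
      assume "g \<otimes> h = h \<otimes> g"
      then show "act g h = h" using that by (simp add: act_eq m_assoc Units_closed)
    qed
    have cardG: "int (order ?G) = int q ^ n - 1"
      using finite n one0 q2 by (simp add: order_def carG of_nat_diff)
    \<comment> \<open>Counting only noncentral elements, a class contributes its size or, if central, nothing.\<close>
    define f where "f = (\<lambda>x. if x \<in> Z then 0 else 1 :: int)"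
    have "m dvd (\<Sum>x\<in>orb. f x)" if orb_in: "orb \<in> orbits ?G (carrier ?G) act" for orb
    proof -
      obtain x where x: "x \<in> Units R" and orb: "orb = orbit ?G act x"
        using orb_in by (auto simp: orbits_def units_of_carrier)
      have xc: "x \<in> carrier R" using x by blast
      show ?thesis
      proof (cases "x \<in> Z")
        case True
        have "act g x = x" if "g \<in> Units R" for g
          using True that x by (subst fixed_iff) (auto simp: Z_def centralizer_def)
        then have "orb \<subseteq> {x}" by (auto simp: orb orbit_def units_of_carrier)
        then have "(\<Sum>x\<in>orb. f x) = 0" using True by (intro sum.neutral) (auto simp: f_def)
        then show ?thesis by simp
      next
        case False
        have "y \<notin> Z" if y: "y \<in> orb" for y
        proof
          assume "y \<in> Z"
          from y obtain g where g: "g \<in> Units R" and yg: "y = act g x"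
            by (auto simp: orb orbit_def units_of_carrier)
          have "y \<otimes> g = g \<otimes> x"
            using g x xc by (simp add: yg act_eq m_assoc Units_closed)
          moreover have "y \<otimes> g = g \<otimes> y"
            using \<open>y \<in> Z\<close> g by (auto simp: Z_def centralizer_def)
          ultimately have "x = y"
            using g xc \<open>y \<in> Z\<close> by (metis Units_l_cancel Z.K_closed)
          with \<open>y \<in> Z\<close> False show False by simp
        qed
        then have sum: "(\<Sum>x\<in>orb. f x) = int (card orb)" by (simp add: f_def)
        let ?C = "centralizer R {x}"
        have Yc: "{x} \<subseteq> carrier R" using xc by simp
        interpret C: division_subring R ?C by (rule division[OF Yc])
        \<comment> \<open>The centralizer is free over the center, and the ring is free over the centralizer.\<close>
        obtain d where d: "card ?C = q ^ d"
          using Z.card_submodule[OF mod[OF Z.subring_K C.subring_K Z_sub[OF Yc] Z.division_subring_axioms]]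
          by (auto simp: q_def)
        obtain e where e: "card (carrier R) = card ?C ^ e"
          using C.card_submodule[OF mod[OF C.subring_K carrier_is_subring _ C.division_subring_axioms]]
            subringE(1)[OF C.subring_K] by auto
        have "q ^ n = q ^ (d * e)" using n d e by (simp add: power_mult)
        then have "n = d * e" using q2 by (simp add: power_inject_exp)
        then have "d dvd n" by simp
        have "?C \<noteq> carrier R"
          using False xc by (force simp: Z_def centralizer_def)
        then have "card ?C < card (carrier R)"
          using finite subringE(1)[OF C.subring_K] by (intro psubset_card_mono) auto
        then have "d < n" using n d q2 by (simp add: power_strict_increasing_iff)
        have "stabilizer ?G act x = ?C - {\<zero>}"
          using x fixed_iff units
          by (auto simp: stabilizer_def units_of_carrier centralizer_def)
        then have "int (card (stabilizer ?G act x)) = int q ^ d - 1"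
          using d q2 subringE(2)[OF C.subring_K] by (simp add: of_nat_diff)
        moreover have "card orb * card (stabilizer ?G act x) = order ?G"
          unfolding orb using x by (intro act.orbit_stabilizer_theorem) (simp add: units_of_carrier)
        ultimately have "int (card orb) * (int q ^ d - 1) = int q ^ n - 1"
          using cardG by (metis of_nat_mult)
        then show ?thesis unfolding sum by (intro mdvd[OF \<open>d dvd n\<close> \<open>d < n\<close>])
      qed
    qed
    then have "m dvd (\<Sum>orb\<in>orbits ?G (carrier ?G) act. \<Sum>x\<in>orb. f x)" by (rule dvd_sum)
    also have "\<dots> = (\<Sum>x\<in>carrier ?G. f x)"
      using finite by (intro act.disjoint_sum) (simp add: carG)
    also have "\<dots> = int (card (carrier R - Z))"
    proof -
      have "(\<Sum>x\<in>carrier ?G. f x) = (\<Sum>x\<in>carrier R - Z. 1)"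
        unfolding f_def carG using finite subringE(2)[OF Z.subring_K]
        by (intro sum.mono_neutral_cong_right) auto
      then show ?thesis by simp
    qed
    also have "\<dots> = int q ^ n - int q"
    proof -
      have "Z \<subseteq> carrier R" using subringE(1)[OF Z.subring_K] .
      then have "card (carrier R - Z) = q ^ n - q" "q \<le> q ^ n"
        using finite n card_mono[of "carrier R" Z]
        by (auto simp: card_Diff_subset finite_subset q_def)
      then show ?thesis by (simp add: of_nat_diff)
    qed
    finally have "m dvd (int q ^ n - 1) - (int q ^ n - int q)" using m by (rule dvd_diff[rotated])
    then have "m dvd int q - 1" by simp
    then have "\<bar>m\<bar> \<le> int q - 1" using q2 dvd_imp_le_int[of "int q - 1" m] by simp
    with mgt show ?thesis by simp
  qed
  then have comm: "x \<otimes> y = y \<otimes> x" if "x \<in> carrier R" "y \<in> carrier R" for x y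
    using that unfolding Z_def centralizer_def by blast
  have "cring R" by unfold_locales (simp add: comm)
  then show ?thesis using units by (rule cring.cring_fieldI)
qed

section \<open>Idealizers of a space of invertible elements\<close>

text \<open>
  Inverses stay in \<open>F\<close>, since left multiplication by a unit of \<open>F\<close> is an injective self-map of the
  finite set \<open>F\<close> and hence attains \<open>\<one>\<close>.
\<close>

lemma (in ring) finite_subring_of_units_is_field:
  assumes finite: "finite (carrier R)" and F: "subring F R"
    and one0: "\<one> \<noteq> \<zero>" and units: "F - {\<zero>} \<subseteq> Units R"
  shows "field (R\<lparr>carrier := F\<rparr>)"
proof -
  have Fc: "F \<subseteq> carrier R" and finF: "finite F"
    using subringE(1)[OF F] finite finite_subset by auto
  have "\<exists>x\<in>F. x \<otimes> f = \<one> \<and> f \<otimes> x = \<one>" if f: "f \<in> F" "f \<noteq> \<zero>" for f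
  proof -
    have fu: "f \<in> Units R" using f units by blast
    have "inj_on (\<lambda>x. f \<otimes> x) F"
      using Units_l_cancel[OF fu] Fc by (intro inj_onI) blast
    moreover have "(\<lambda>x. f \<otimes> x) ` F \<subseteq> F" using f subringE(6)[OF F] by blast
    ultimately have "\<one> \<in> (\<lambda>x. f \<otimes> x) ` F"
      using endo_inj_surj[OF finF] subringE(3)[OF F] by blast
    then obtain x where x: "x \<in> F" "f \<otimes> x = \<one>" by force
    have xc: "x \<in> carrier R" using x Fc by blast
    have "x = inv f \<otimes> f \<otimes> x" using fu xc by simp
    also have "\<dots> = inv f \<otimes> (f \<otimes> x)"
      using fu xc by (simp only: m_assoc Units_inv_closed Units_closed)
    also have "\<dots> = inv f" using fu by (simp add: x)
    finally have "x \<otimes> f = \<one>" using fu by simp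
    with x show ?thesis by blast
  qed
  then have "F - {\<zero>} \<subseteq> Units (R\<lparr>carrier := F\<rparr>)" by (auto simp: Units_def)
  moreover have "\<zero> \<notin> Units (R\<lparr>carrier := F\<rparr>)"
  proof
    assume "\<zero> \<in> Units (R\<lparr>carrier := F\<rparr>)"
    then obtain x where "x \<in> F" "x \<otimes> \<zero> = \<one>" by (auto simp: Units_def)
    then show False using Fc one0 by auto
  qed
  moreover have "Units (R\<lparr>carrier := F\<rparr>) \<subseteq> F" by (auto simp: Units_def)
  ultimately have "Units (R\<lparr>carrier := F\<rparr>) = F - {\<zero>}" by blast
  then show ?thesis
    using ring.wedderburn_little[OF subring_is_ring[OF F]] finF by simp
qed

lemma (in ring) field_contained_inI:
  assumes "F \<subseteq> carrier R" "field (R\<lparr>carrier := F\<rparr>)"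
  shows "field_contained_in R F"
  unfolding field_contained_in_def
proof (intro conjI exI)
  show "field (R\<lparr>carrier := F, ring.zero := \<zero>, monoid.one := \<one>\<rparr>)"
    using assms(2) by simp
qed (rule assms(1))

text \<open>
  The largest field with a property of this kind is the set of all admissible elements, as soon as
  that set is a field.
\<close>

lemma (in ring) greatest_field:
  assumes "F \<subseteq> carrier R" "field (R\<lparr>carrier := F\<rparr>)"
    and "\<And>E. P E \<longleftrightarrow> field_contained_in R E \<and> E \<subseteq> F"
  shows "is_largest P F" and "(GREATEST E. P E) = F"
proof -
  show largest: "is_largest P F"
    using field_contained_inI[OF assms(1,2)] assms(3) by (simp add: is_largest_def)
  then show "(GREATEST E. P E) = F"
    by (intro Greatest_equality) (auto simp: is_largest_def)
qed

definition left_idealizer :: "('c, 'm) ring_scheme \<Rightarrow> 'c set \<Rightarrow> 'c set" where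
  "left_idealizer V C = {f \<in> carrier V. \<forall>c\<in>C. f \<otimes>\<^bsub>V\<^esub> c \<in> C}"

definition right_idealizer :: "('c, 'm) ring_scheme \<Rightarrow> 'c set \<Rightarrow> 'c set" where
  "right_idealizer V C = {f \<in> carrier V. \<forall>c\<in>C. c \<otimes>\<^bsub>V\<^esub> f \<in> C}"

definition conj_by :: "('c, 'm) ring_scheme \<Rightarrow> 'c \<Rightarrow> 'c \<Rightarrow> 'c" where
  "conj_by V u f = inv\<^bsub>V\<^esub> u \<otimes>\<^bsub>V\<^esub> f \<otimes>\<^bsub>V\<^esub> u"

text \<open>
  If \<open>w\<close> is the identity, these are the elements of the left idealizer that commute with \<open>C\<close>.  If
  \<open>w\<close> is a unit in \<open>C\<close>, the translate \<open>C w\<^sup>-\<^sup>1\<close> contains the identity, and the elements are those of the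
  left idealizer that commute with this translate.
\<close>

definition left_central :: "('c, 'm) ring_scheme \<Rightarrow> 'c set \<Rightarrow> 'c \<Rightarrow> 'c set" where
  "left_central V C w = {f \<in> left_idealizer V C. \<forall>c\<in>C. f \<otimes>\<^bsub>V\<^esub> c = c \<otimes>\<^bsub>V\<^esub> conj_by V w f}"

definition right_central :: "('c, 'm) ring_scheme \<Rightarrow> 'c set \<Rightarrow> 'c \<Rightarrow> 'c set" where
  "right_central V C s =
     {f \<in> right_idealizer V C. \<forall>c\<in>C. c \<otimes>\<^bsub>V\<^esub> f = conj_by V (inv\<^bsub>V\<^esub> s) f \<otimes>\<^bsub>V\<^esub> c}"

definition translate :: "('c, 'm) ring_scheme \<Rightarrow> 'c set \<Rightarrow> 'c \<Rightarrow> 'c set" where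
  "translate V C h = (\<lambda>c. c \<otimes>\<^bsub>V\<^esub> h) ` C"

context ring
begin

lemma inv_cancel_left [simp]:
  assumes "u \<in> Units R" "x \<in> carrier R"
  shows "inv u \<otimes> (u \<otimes> x) = x" "u \<otimes> (inv u \<otimes> x) = x"
  using assms by (simp_all add: Units_closed flip: m_assoc)

lemma unit_right_cancel:
  assumes u: "u \<in> Units R" and xy: "x \<in> carrier R" "y \<in> carrier R"
  shows "x \<otimes> u = y \<otimes> u \<longleftrightarrow> x = y"
proof
  assume "x \<otimes> u = y \<otimes> u"
  then have "x \<otimes> u \<otimes> inv u = y \<otimes> u \<otimes> inv u" by simp
  then show "x = y" using u xy by (simp add: m_assoc Units_closed)
qed simp

lemma inv_unit_mult:
  assumes "u \<in> Units R" "v \<in> Units R"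
  shows "inv (u \<otimes> v) = inv v \<otimes> inv u"
proof (rule inv_char)
  show "u \<otimes> v \<otimes> (inv v \<otimes> inv u) = \<one>" "inv v \<otimes> inv u \<otimes> (u \<otimes> v) = \<one>"
    using assms by (simp_all add: m_assoc Units_closed)
qed (use assms in \<open>simp_all add: Units_closed\<close>)

lemma conj_by_closed [simp]: "u \<in> Units R \<Longrightarrow> f \<in> carrier R \<Longrightarrow> conj_by R u f \<in> carrier R"
  by (simp add: conj_by_def Units_closed)

lemma conj_by_inv:
  assumes "u \<in> Units R" "f \<in> carrier R"
  shows "conj_by R (inv u) (conj_by R u f) = f" "conj_by R u (conj_by R (inv u) f) = f"
  using assms by (simp_all add: conj_by_def Units_closed m_assoc)

lemma conj_by_hom:
  assumes u: "u \<in> Units R"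
  shows "conj_by R u \<in> ring_hom R R"
  by (rule ring_hom_memI)
     (use u in \<open>simp_all add: conj_by_def Units_closed m_assoc r_distr l_distr\<close>)

lemma conj_by_iso:
  assumes u: "u \<in> Units R" and A: "A \<subseteq> carrier R"
  shows "R\<lparr>carrier := A\<rparr> \<simeq> R\<lparr>carrier := conj_by R u ` A\<rparr>"
proof -
  have "inj_on (conj_by R u) A"
    by (rule inj_on_inverseI[where g = "conj_by R (inv u)"]) (use conj_by_inv(1)[OF u] A in blast)
  moreover have "conj_by R u \<in> ring_hom (R\<lparr>carrier := A\<rparr>) (R\<lparr>carrier := conj_by R u ` A\<rparr>)"
  proof (rule ring_hom_memI)
    fix x y assume "x \<in> carrier (R\<lparr>carrier := A\<rparr>)" "y \<in> carrier (R\<lparr>carrier := A\<rparr>)"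
    then have "x \<in> carrier R" "y \<in> carrier R" using A by auto
    then show "conj_by R u (x \<otimes>\<^bsub>R\<lparr>carrier := A\<rparr>\<^esub> y)
          = conj_by R u x \<otimes>\<^bsub>R\<lparr>carrier := conj_by R u ` A\<rparr>\<^esub> conj_by R u y"
        "conj_by R u (x \<oplus>\<^bsub>R\<lparr>carrier := A\<rparr>\<^esub> y)
          = conj_by R u x \<oplus>\<^bsub>R\<lparr>carrier := conj_by R u ` A\<rparr>\<^esub> conj_by R u y"
      using ring_hom_memE(2,3)[OF conj_by_hom[OF u]] by simp_all
  qed (use ring_hom_memE(4)[OF conj_by_hom[OF u]] in simp_all)
  ultimately have "conj_by R u \<in> ring_iso (R\<lparr>carrier := A\<rparr>) (R\<lparr>carrier := conj_by R u ` A\<rparr>)"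
    by (simp add: ring_iso_def bij_betw_def)
  then show ?thesis unfolding is_ring_iso_def by blast
qed

text \<open>
  Both versions of the twisted commutation rule have this form, with one of \<open>s\<close>, \<open>t\<close> the identity
  and the other one a conjugation.
\<close>

lemma intertwiner_subring:
  assumes C: "C \<subseteq> carrier R" and s: "s \<in> ring_hom R R" and t: "t \<in> ring_hom R R"
  shows "subring {f \<in> carrier R. \<forall>c\<in>C. s f \<otimes> c = c \<otimes> t f} R"
proof -
  interpret s: ring_hom_ring R R s
    using s ring_axioms by (intro ring_hom_ring.intro ring_hom_ring_axioms.intro)
  interpret t: ring_hom_ring R R t
    using t ring_axioms by (intro ring_hom_ring.intro ring_hom_ring_axioms.intro)
  have Cc: "c \<in> carrier R" if "c \<in> C" for c using that C by blast
  show ?thesis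
  proof (rule subringI)
    fix f g assume fg: "f \<in> {f \<in> carrier R. \<forall>c\<in>C. s f \<otimes> c = c \<otimes> t f}"
      "g \<in> {f \<in> carrier R. \<forall>c\<in>C. s f \<otimes> c = c \<otimes> t f}"
    then have car: "f \<in> carrier R" "g \<in> carrier R" by auto
    have "s (f \<otimes> g) \<otimes> c = c \<otimes> t (f \<otimes> g)" if c: "c \<in> C" for c
    proof -
      have "s (f \<otimes> g) \<otimes> c = s f \<otimes> (s g \<otimes> c)" using car Cc[OF c] by (simp add: m_assoc)
      also have "s g \<otimes> c = c \<otimes> t g" using fg c by blast
      also have "s f \<otimes> (c \<otimes> t g) = (s f \<otimes> c) \<otimes> t g" using car Cc[OF c] by (simp add: m_assoc)
      also have "s f \<otimes> c = c \<otimes> t f" using fg c by blast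
      also have "(c \<otimes> t f) \<otimes> t g = c \<otimes> t (f \<otimes> g)" using car Cc[OF c] by (simp add: m_assoc)
      finally show ?thesis .
    qed
    then show "f \<otimes> g \<in> {f \<in> carrier R. \<forall>c\<in>C. s f \<otimes> c = c \<otimes> t f}" using fg by simp
  qed (use Cc in \<open>auto simp: l_minus r_minus l_distr r_distr\<close>)
qed

end

text \<open>
  The properties of a spread set, as a subset of the endomorphism ring, from which the structure
  of its idealizers follows.
\<close>

locale spread_space = ring V for V (structure) +
  fixes C
  assumes finite_V: "finite (carrier V)"
    and C_subset: "C \<subseteq> carrier V"
    and C_zero: "\<zero> \<in> C"
    and C_add: "\<lbrakk>c \<in> C; d \<in> C\<rbrakk> \<Longrightarrow> c \<oplus> d \<in> C"
    and C_minus: "c \<in> C \<Longrightarrow> \<ominus> c \<in> C"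
    and C_nontrivial: "C \<noteq> {\<zero>}"
    and C_units: "\<lbrakk>c \<in> C; c \<noteq> \<zero>\<rbrakk> \<Longrightarrow> c \<in> Units V"
begin

lemma C_closed: "c \<in> C \<Longrightarrow> c \<in> carrier V"
  using C_subset by blast

lemma obtain_unit: obtains u where "u \<in> C" "u \<in> Units V" "u \<noteq> \<zero>"
  using C_zero C_nontrivial C_units by blast

lemma one_not_zero: "\<one> \<noteq> \<zero>"
proof
  assume eq: "\<one> = \<zero>"
  obtain u where u: "u \<in> C" "u \<noteq> \<zero>" by (rule obtain_unit)
  have "u = u \<otimes> \<one>" using C_closed[OF u(1)] by simp
  also have "\<dots> = \<zero>" using C_closed[OF u(1)] by (simp add: eq)
  finally show False using u by simp
qed

lemma left_idealizer_subring: "subring (left_idealizer V C) V"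
  by (rule subringI)
     (auto simp: left_idealizer_def C_closed m_assoc l_distr C_add l_minus C_minus)

lemma right_idealizer_subring: "subring (right_idealizer V C) V"
  by (rule subringI)
     (auto simp: right_idealizer_def C_closed r_distr C_add r_minus C_minus simp flip: m_assoc)

text \<open>
  If \<open>u\<close> is a unit in \<open>C\<close>, then \<open>f \<otimes> u\<close> is a nonzero element of \<open>C\<close> and therefore a unit.
\<close>

lemma left_idealizer_units:
  assumes f: "f \<in> left_idealizer V C" "f \<noteq> \<zero>"
  shows "f \<in> Units V"
proof -
  have fc: "f \<in> carrier V" using f by (simp add: left_idealizer_def)
  obtain u where u: "u \<in> C" "u \<in> Units V" by (rule obtain_unit)
  have eq: "f = (f \<otimes> u) \<otimes> inv u" using u fc by (simp add: m_assoc Units_closed)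
  have "f \<otimes> u \<noteq> \<zero>"
  proof
    assume "f \<otimes> u = \<zero>"
    with eq have "f = \<zero> \<otimes> inv u" by (simp only:)
    then show False using f(2) u by simp
  qed
  moreover have "f \<otimes> u \<in> C" using f u by (simp add: left_idealizer_def)
  ultimately have "f \<otimes> u \<in> Units V" using C_units by blast
  then have "f \<otimes> u \<otimes> inv u \<in> Units V" using u by (simp add: Units_m_closed)
  then show ?thesis by (simp only: eq[symmetric])
qed

lemma right_idealizer_units:
  assumes f: "f \<in> right_idealizer V C" "f \<noteq> \<zero>"
  shows "f \<in> Units V"
proof -
  have fc: "f \<in> carrier V" using f by (simp add: right_idealizer_def)
  obtain u where u: "u \<in> C" "u \<in> Units V" by (rule obtain_unit)
  have eq: "f = inv u \<otimes> (u \<otimes> f)" using u fc by simp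
  have "u \<otimes> f \<noteq> \<zero>"
  proof
    assume "u \<otimes> f = \<zero>"
    with eq have "f = inv u \<otimes> \<zero>" by (simp only:)
    then show False using f(2) u by simp
  qed
  moreover have "u \<otimes> f \<in> C" using f u by (simp add: right_idealizer_def)
  ultimately have "u \<otimes> f \<in> Units V" using C_units by blast
  then have "inv u \<otimes> (u \<otimes> f) \<in> Units V" using u by (simp add: Units_m_closed)
  then show ?thesis by (simp only: eq[symmetric])
qed

lemma subring_of_left_idealizer_field:
  assumes "subring F V" "F \<subseteq> left_idealizer V C"
  shows "field (V\<lparr>carrier := F\<rparr>)"
proof (rule finite_subring_of_units_is_field[OF finite_V assms(1) one_not_zero])
  show "F - {\<zero>} \<subseteq> Units V" using assms(2) left_idealizer_units by blast
qed

lemma subring_of_right_idealizer_field: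
  assumes "subring F V" "F \<subseteq> right_idealizer V C"
  shows "field (V\<lparr>carrier := F\<rparr>)"
proof (rule finite_subring_of_units_is_field[OF finite_V assms(1) one_not_zero])
  show "F - {\<zero>} \<subseteq> Units V" using assms(2) right_idealizer_units by blast
qed

lemma id_hom: "(\<lambda>f. f) \<in> ring_hom V V"
  by (rule ring_hom_memI) auto

lemma left_central_subring:
  assumes "w \<in> Units V"
  shows "subring (left_central V C w) V"
proof -
  have "left_central V C w =
      left_idealizer V C \<inter> {f \<in> carrier V. \<forall>c\<in>C. f \<otimes> c = c \<otimes> conj_by V w f}"
    by (auto simp: left_central_def left_idealizer_def)
  then show ?thesis
    using subring_inter[OF left_idealizer_subring
        intertwiner_subring[OF C_subset id_hom conj_by_hom[OF assms]]] by simp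
qed

lemma right_central_subring:
  assumes "s \<in> Units V"
  shows "subring (right_central V C s) V"
proof -
  have "right_central V C s =
      right_idealizer V C \<inter> {f \<in> carrier V. \<forall>c\<in>C. conj_by V (inv s) f \<otimes> c = c \<otimes> f}"
    by (auto simp: right_central_def right_idealizer_def)
  then show ?thesis
    using subring_inter[OF right_idealizer_subring
        intertwiner_subring[OF C_subset conj_by_hom[OF Units_inv_Units[OF assms]] id_hom]] by simp
qed

lemma left_idealizer_field: "field (V\<lparr>carrier := left_idealizer V C\<rparr>)"
  by (rule subring_of_left_idealizer_field[OF left_idealizer_subring subset_refl])

lemma right_idealizer_field: "field (V\<lparr>carrier := right_idealizer V C\<rparr>)"
  by (rule subring_of_right_idealizer_field[OF right_idealizer_subring order_refl])

lemma left_central_field: "w \<in> Units V \<Longrightarrow> field (V\<lparr>carrier := left_central V C w\<rparr>)"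
  by (rule subring_of_left_idealizer_field[OF left_central_subring])
     (auto simp: left_central_def)

lemma right_central_field: "s \<in> Units V \<Longrightarrow> field (V\<lparr>carrier := right_central V C s\<rparr>)"
  by (rule subring_of_right_idealizer_field[OF right_central_subring])
     (auto simp: right_central_def)

text \<open>
  The rule for \<open>v\<close>, applied to \<open>w \<in> C\<close>, says that the conjugates of \<open>f\<close> by \<open>v\<close> and by \<open>w\<close> coincide.
\<close>

lemma left_central_base_change:
  assumes v: "v \<in> C" "v \<in> Units V" and w: "w \<in> C" "w \<in> Units V"
  shows "left_central V C v = left_central V C w"
proof -
  have "left_central V C v \<subseteq> left_central V C w"
    if v: "v \<in> C" "v \<in> Units V" and w: "w \<in> C" "w \<in> Units V" for v w
  proof
    fix f assume f: "f \<in> left_central V C v"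
    then have fc: "f \<in> carrier V" by (simp add: left_central_def left_idealizer_def)
    have "f \<otimes> w = w \<otimes> conj_by V v f" using f w by (simp add: left_central_def)
    then have "inv w \<otimes> f \<otimes> w = conj_by V v f"
      using fc v w by (simp add: m_assoc Units_closed)
    then have "conj_by V w f = conj_by V v f" by (simp only: conj_by_def)
    with f show "f \<in> left_central V C w" by (simp add: left_central_def)
  qed
  from this[OF v w] this[OF w v] show ?thesis by blast
qed

text \<open>
  For \<open>f = s\<^sup>-\<^sup>1 g s\<close>, both commutation rules read \<open>g \<otimes> c = c \<otimes> f\<close>; this common product lies in \<open>C\<close>
  as soon as \<open>f\<close> or \<open>g\<close> is in the respective idealizer.
\<close>

lemma right_central_eq_conj_left_central:
  assumes s: "s \<in> C" "s \<in> Units V"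
  shows "right_central V C s = conj_by V s ` left_central V C s"
proof (intro equalityI subsetI)
  fix f assume f: "f \<in> right_central V C s"
  then have fc: "f \<in> carrier V" by (simp add: right_central_def right_idealizer_def)
  define g where "g = conj_by V (inv s) f"
  have fg: "f = conj_by V s g" and gc: "g \<in> carrier V"
    using fc s by (simp_all add: g_def conj_by_inv)
  have eq: "g \<otimes> c = c \<otimes> f" if "c \<in> C" for c
    using f that by (simp add: right_central_def g_def)
  moreover have "c \<otimes> f \<in> C" if "c \<in> C" for c
    using f that unfolding right_central_def right_idealizer_def by blast
  ultimately have "g \<in> left_central V C s"
    using gc by (simp add: left_central_def left_idealizer_def fg)
  with fg show "f \<in> conj_by V s ` left_central V C s" by blast
next
  fix f assume "f \<in> conj_by V s ` left_central V C s"
  then obtain g where g: "g \<in> left_central V C s" and fg: "f = conj_by V s g" by blast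
  have gc: "g \<in> carrier V" using g by (simp add: left_central_def left_idealizer_def)
  have "conj_by V (inv s) f = g" using gc s by (simp add: fg conj_by_inv)
  moreover have eq: "c \<otimes> f = g \<otimes> c" if "c \<in> C" for c
    using g that by (simp add: left_central_def fg)
  moreover have "g \<otimes> c \<in> C" if "c \<in> C" for c
    using g that unfolding left_central_def left_idealizer_def by blast
  ultimately show "f \<in> right_central V C s"
    using gc s by (simp add: right_central_def right_idealizer_def fg)
qed

lemma translate_cancel:
  assumes "h \<in> Units V" "x \<in> carrier V"
  shows "x \<otimes> h \<in> translate V C h \<longleftrightarrow> x \<in> C"
  using assms C_closed by (auto simp: translate_def unit_right_cancel)

lemma left_idealizer_translate:
  assumes h: "h \<in> Units V"
  shows "left_idealizer V (translate V C h) = left_idealizer V C"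
proof -
  have "f \<otimes> (c \<otimes> h) \<in> translate V C h \<longleftrightarrow> f \<otimes> c \<in> C" if "f \<in> carrier V" "c \<in> C" for f c
    using translate_cancel[OF h, of "f \<otimes> c"] that h C_closed by (simp add: m_assoc Units_closed)
  then show ?thesis
    by (auto simp: left_idealizer_def) (auto simp: translate_def)
qed

text \<open>
  This rests on \<open>(c h) (h\<^sup>-\<^sup>1 f h) = (c f) h\<close>.
\<close>

lemma right_idealizer_translate:
  assumes h: "h \<in> Units V"
  shows "right_idealizer V (translate V C h) = conj_by V h ` right_idealizer V C"
proof -
  have key: "c \<otimes> h \<otimes> conj_by V h f \<in> translate V C h \<longleftrightarrow> c \<otimes> f \<in> C"
    if "f \<in> carrier V" "c \<in> C" for f c
  proof -
    have "c \<otimes> h \<otimes> conj_by V h f = c \<otimes> f \<otimes> h"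
      using that h C_closed by (simp add: conj_by_def m_assoc Units_closed)
    then show ?thesis using translate_cancel[OF h, of "c \<otimes> f"] that C_closed by simp
  qed
  show ?thesis
  proof (intro equalityI subsetI)
    fix g assume g: "g \<in> right_idealizer V (translate V C h)"
    then have gc: "g \<in> carrier V" by (simp add: right_idealizer_def)
    define f where "f = conj_by V (inv h) g"
    have gf: "g = conj_by V h f" and fc: "f \<in> carrier V"
      using gc h by (simp_all add: f_def conj_by_inv)
    have "c \<otimes> f \<in> C" if "c \<in> C" for c
      using g key[OF fc that] that by (auto simp: right_idealizer_def translate_def gf)
    then show "g \<in> conj_by V h ` right_idealizer V C"
      using gf fc by (auto simp: right_idealizer_def)
  next
    fix g assume "g \<in> conj_by V h ` right_idealizer V C"
    then obtain f where gf: "g = conj_by V h f" and f: "f \<in> right_idealizer V C" by blast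
    have fc: "f \<in> carrier V" using f by (simp add: right_idealizer_def)
    have "c \<otimes> h \<otimes> g \<in> translate V C h" if "c \<in> C" for c
      using f key[OF fc that] that by (simp add: right_idealizer_def gf)
    then show "g \<in> right_idealizer V (translate V C h)"
      using fc h by (auto simp: right_idealizer_def gf translate_def)
  qed
qed

text \<open>
  Conjugation by \<open>w \<otimes> h\<close> is conjugation by \<open>w\<close> followed by conjugation by \<open>h\<close>, and the latter cancels
  against the factor \<open>h\<close> on the right of the elements of the translate.
\<close>

lemma left_central_translate:
  assumes h: "h \<in> Units V" and w: "w \<in> Units V"
  shows "left_central V (translate V C h) (w \<otimes> h) = left_central V C w"
proof -
  have "f \<otimes> (c \<otimes> h) = c \<otimes> h \<otimes> conj_by V (w \<otimes> h) f \<longleftrightarrow> f \<otimes> c = c \<otimes> conj_by V w f"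
    if f: "f \<in> carrier V" and c: "c \<in> C" for f c
  proof -
    have "c \<otimes> h \<otimes> conj_by V (w \<otimes> h) f = c \<otimes> conj_by V w f \<otimes> h"
      using f C_closed[OF c] h w by (simp add: conj_by_def inv_unit_mult m_assoc Units_closed)
    moreover have "f \<otimes> (c \<otimes> h) = f \<otimes> c \<otimes> h"
      using f C_closed[OF c] h by (simp add: m_assoc Units_closed)
    ultimately show ?thesis
      using f C_closed[OF c] h w by (simp add: unit_right_cancel)
  qed
  then show ?thesis
    unfolding left_central_def left_idealizer_translate[OF h]
    by (auto simp: translate_def left_idealizer_def)
qed

lemma spread_space_translate:
  assumes h: "h \<in> Units V"
  shows "spread_space V (translate V C h)"
proof (intro spread_space.intro spread_space_axioms.intro ring_axioms finite_V)
  have hc: "h \<in> carrier V" using h by blast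
  show "translate V C h \<subseteq> carrier V" using C_closed hc by (auto simp: translate_def)
  show "\<zero> \<in> translate V C h"
    unfolding translate_def by (rule image_eqI[OF _ C_zero]) (simp add: hc)
  show "c \<oplus> d \<in> translate V C h" if "c \<in> translate V C h" "d \<in> translate V C h" for c d
    using that C_add C_closed hc by (auto simp: translate_def simp flip: l_distr)
  show "\<ominus> c \<in> translate V C h" if "c \<in> translate V C h" for c
    using that C_minus C_closed hc by (auto simp: translate_def simp flip: l_minus)
  show "translate V C h \<noteq> {\<zero>}"
  proof
    assume "translate V C h = {\<zero>}"
    moreover obtain u where u: "u \<in> C" "u \<in> Units V" "u \<noteq> \<zero>" by (rule obtain_unit)
    ultimately have "u \<otimes> h = \<zero> \<otimes> h" using hc by (auto simp: translate_def)
    then show False using u C_closed[OF u(1)] h by (simp add: unit_right_cancel del: l_null)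
  qed
  show "c \<in> Units V" if c: "c \<in> translate V C h" "c \<noteq> \<zero>" for c
  proof -
    obtain d where d: "d \<in> C" "c = d \<otimes> h" using c by (auto simp: translate_def)
    then have "d \<noteq> \<zero>" using c hc by auto
    then show ?thesis using d C_units h by simp
  qed
qed

end

section \<open>Endomorphisms and the spread set\<close>

text \<open>
  The scalars act as repeated addition, which every additive map respects.
\<close>

lemma Fp_linear_iff_additive:
  assumes "abelian_group S" "abelian_group T"
  shows "Fp_linear p S T f \<longleftrightarrow> f \<in> carrier S \<rightarrow> carrier T \<and>
    (\<forall>x\<in>carrier S. \<forall>y\<in>carrier S. f (x \<oplus>\<^bsub>S\<^esub> y) = f x \<oplus>\<^bsub>T\<^esub> f y)"
proof -
  interpret S: abelian_group S by fact
  interpret T: abelian_group T by fact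
  have "f ([k] \<cdot>\<^bsub>S\<^esub> x) = [k] \<cdot>\<^bsub>T\<^esub> f x"
    if f: "f \<in> carrier S \<rightarrow> carrier T"
      and add: "\<forall>x\<in>carrier S. \<forall>y\<in>carrier S. f (x \<oplus>\<^bsub>S\<^esub> y) = f x \<oplus>\<^bsub>T\<^esub> f y"
      and x: "x \<in> carrier S" for k :: nat and x
  proof (induction k)
    case 0
    have "f \<zero>\<^bsub>S\<^esub> \<oplus>\<^bsub>T\<^esub> f \<zero>\<^bsub>S\<^esub> = f \<zero>\<^bsub>S\<^esub>"
      using add[rule_format, OF S.zero_closed S.zero_closed] by simp
    then have "f \<zero>\<^bsub>S\<^esub> = \<zero>\<^bsub>T\<^esub>" using f by (simp add: Pi_iff)
    then show ?case by simp
  next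
    case (Suc k)
    then show ?case using f x add by (simp add: Pi_iff)
  qed
  then show ?thesis unfolding Fp_linear_def by blast
qed

context abelian_group
begin

lemma carrier_Fp_End:
  "f \<in> carrier (Fp_End p G) \<longleftrightarrow> f \<in> extensional (carrier G) \<and> f \<in> carrier G \<rightarrow> carrier G \<and>
     (\<forall>x\<in>carrier G. \<forall>y\<in>carrier G. f (x \<oplus> y) = f x \<oplus> f y)"
  by (simp add: Fp_End_def Fp_linear_iff_additive[OF abelian_group_axioms abelian_group_axioms])

lemma Fp_End_eqI:
  assumes "f \<in> carrier (Fp_End p G)" "g \<in> carrier (Fp_End p G)"
    and "\<And>x. x \<in> carrier G \<Longrightarrow> f x = g x"
  shows "f = g"
  using assms by (intro extensionalityI[of _ "carrier G"]) (auto simp: carrier_Fp_End)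

lemma Fp_End_closed: "f \<in> carrier (Fp_End p G) \<Longrightarrow> x \<in> carrier G \<Longrightarrow> f x \<in> carrier G"
  by (auto simp: carrier_Fp_End)

lemma Fp_End_additive:
  "\<lbrakk>f \<in> carrier (Fp_End p G); x \<in> carrier G; y \<in> carrier G\<rbrakk> \<Longrightarrow> f (x \<oplus> y) = f x \<oplus> f y"
  by (simp add: carrier_Fp_End)

lemma Fp_End_ops:
  "f \<otimes>\<^bsub>Fp_End p G\<^esub> g = compose (carrier G) f g"
  "\<one>\<^bsub>Fp_End p G\<^esub> = (\<lambda>x\<in>carrier G. x)"
  "\<zero>\<^bsub>Fp_End p G\<^esub> = (\<lambda>x\<in>carrier G. \<zero>)"
  "f \<oplus>\<^bsub>Fp_End p G\<^esub> g = (\<lambda>x\<in>carrier G. f x \<oplus> g x)"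
  by (simp_all add: Fp_End_def)

lemma Fp_End_apply:
  assumes "x \<in> carrier G"
  shows "(f \<otimes>\<^bsub>Fp_End p G\<^esub> g) x = f (g x)" "\<one>\<^bsub>Fp_End p G\<^esub> x = x"
    "\<zero>\<^bsub>Fp_End p G\<^esub> x = \<zero>" "(f \<oplus>\<^bsub>Fp_End p G\<^esub> g) x = f x \<oplus> g x"
  using assms by (simp_all add: Fp_End_ops compose_def)

lemma Fp_End_ring: "ring (Fp_End p G)"
proof -
  let ?V = "Fp_End p G"
  note [simp] = Fp_End_closed Fp_End_additive Fp_End_apply
  note eqI = Fp_End_eqI[of _ p]
  have add: "f \<oplus>\<^bsub>?V\<^esub> g \<in> carrier ?V" if "f \<in> carrier ?V" "g \<in> carrier ?V" for f g
    using that Fp_End_closed[OF that(1)] Fp_End_closed[OF that(2)]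
    unfolding carrier_Fp_End Fp_End_ops by (auto simp: a_ac)
  have mult: "f \<otimes>\<^bsub>?V\<^esub> g \<in> carrier ?V" if "f \<in> carrier ?V" "g \<in> carrier ?V" for f g
    using that Fp_End_closed[OF that(1)] Fp_End_closed[OF that(2)]
    unfolding carrier_Fp_End Fp_End_ops by (auto simp: compose_def)
  have zero: "\<zero>\<^bsub>?V\<^esub> \<in> carrier ?V" and one: "\<one>\<^bsub>?V\<^esub> \<in> carrier ?V"
    unfolding carrier_Fp_End Fp_End_ops by auto
  show ?thesis
  proof (rule ringI)
    show "abelian_group ?V"
    proof (rule abelian_groupI)
      fix f g h assume fgh: "f \<in> carrier ?V" "g \<in> carrier ?V" "h \<in> carrier ?V"
      show "f \<oplus>\<^bsub>?V\<^esub> g \<oplus>\<^bsub>?V\<^esub> h = f \<oplus>\<^bsub>?V\<^esub> (g \<oplus>\<^bsub>?V\<^esub> h)"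
        by (rule eqI) (use fgh in \<open>simp_all add: add mult zero one a_assoc\<close>)
    next
      fix f g assume fg: "f \<in> carrier ?V" "g \<in> carrier ?V"
      show "f \<oplus>\<^bsub>?V\<^esub> g = g \<oplus>\<^bsub>?V\<^esub> f"
        by (rule eqI) (use fg in \<open>simp_all add: add mult zero one a_comm\<close>)
    next
      fix f assume f: "f \<in> carrier ?V"
      show "\<zero>\<^bsub>?V\<^esub> \<oplus>\<^bsub>?V\<^esub> f = f"
        by (rule eqI) (use f in \<open>simp_all add: add mult zero one\<close>)
      let ?g = "\<lambda>x\<in>carrier G. \<ominus> f x"
      have g: "?g \<in> carrier ?V"
        using f Fp_End_closed[OF f] unfolding carrier_Fp_End by (auto simp: minus_add)
      have "?g \<oplus>\<^bsub>?V\<^esub> f = \<zero>\<^bsub>?V\<^esub>"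
        by (rule eqI) (use f g in \<open>simp_all add: add mult zero one l_neg\<close>)
      with g show "\<exists>g\<in>carrier ?V. g \<oplus>\<^bsub>?V\<^esub> f = \<zero>\<^bsub>?V\<^esub>" by blast
    qed (use add zero in auto)
    show "monoid ?V"
    proof (rule monoidI)
      fix f g h assume fgh: "f \<in> carrier ?V" "g \<in> carrier ?V" "h \<in> carrier ?V"
      show "f \<otimes>\<^bsub>?V\<^esub> g \<otimes>\<^bsub>?V\<^esub> h = f \<otimes>\<^bsub>?V\<^esub> (g \<otimes>\<^bsub>?V\<^esub> h)"
        by (rule eqI) (use fgh in \<open>simp_all add: add mult zero one\<close>)
    next
      fix f assume f: "f \<in> carrier ?V"
      show "\<one>\<^bsub>?V\<^esub> \<otimes>\<^bsub>?V\<^esub> f = f"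
        by (rule eqI) (use f in \<open>simp_all add: add mult zero one\<close>)
      show "f \<otimes>\<^bsub>?V\<^esub> \<one>\<^bsub>?V\<^esub> = f"
        by (rule eqI) (use f in \<open>simp_all add: add mult zero one\<close>)
    qed (use mult one in auto)
  next
    fix f g h assume fgh: "f \<in> carrier ?V" "g \<in> carrier ?V" "h \<in> carrier ?V"
    show "(f \<oplus>\<^bsub>?V\<^esub> g) \<otimes>\<^bsub>?V\<^esub> h = f \<otimes>\<^bsub>?V\<^esub> h \<oplus>\<^bsub>?V\<^esub> g \<otimes>\<^bsub>?V\<^esub> h"
      by (rule eqI) (use fgh in \<open>simp_all add: add mult zero one\<close>)
    show "h \<otimes>\<^bsub>?V\<^esub> (f \<oplus>\<^bsub>?V\<^esub> g) = h \<otimes>\<^bsub>?V\<^esub> f \<oplus>\<^bsub>?V\<^esub> h \<otimes>\<^bsub>?V\<^esub> g"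
      by (rule eqI) (use fgh in \<open>simp_all add: add mult zero one\<close>)
  qed
qed

lemma Fp_End_finite:
  assumes "finite (carrier G)"
  shows "finite (carrier (Fp_End p G))"
proof (rule finite_subset)
  show "carrier (Fp_End p G) \<subseteq> carrier G \<rightarrow>\<^sub>E carrier G"
    by (auto simp: carrier_Fp_End PiE_def)
  show "finite (carrier G \<rightarrow>\<^sub>E carrier G)" using assms by (intro finite_PiE)
qed

lemma Fp_End_Units:
  assumes f: "f \<in> carrier (Fp_End p G)" and bij: "bij_betw f (carrier G) (carrier G)"
  shows "f \<in> Units (Fp_End p G)"
proof -
  let ?V = "Fp_End p G"
  define g where "g = (\<lambda>x\<in>carrier G. inv_into (carrier G) f x)"
  have gc: "g x \<in> carrier G" and fg: "f (g x) = x" if "x \<in> carrier G" for x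
    using bij that bij_betw_imp_surj_on[OF bij] inv_into_into[of x f "carrier G"]
      f_inv_into_f[of x f "carrier G"] by (auto simp: g_def)
  have gf: "g (f x) = x" if "x \<in> carrier G" for x
    using bij that Fp_End_closed[OF f that] by (simp add: g_def bij_betw_inv_into_left)
  have "g (x \<oplus> y) = g x \<oplus> g y" if "x \<in> carrier G" "y \<in> carrier G" for x y
    using gf[of "g x \<oplus> g y"] Fp_End_additive[OF f gc[OF that(1)] gc[OF that(2)]] gc that fg by simp
  then have g: "g \<in> carrier ?V"
    unfolding carrier_Fp_End using gc by (simp add: g_def)
  interpret V: ring ?V by (rule Fp_End_ring)
  have "g \<otimes>\<^bsub>?V\<^esub> f = \<one>\<^bsub>?V\<^esub>"
    by (rule Fp_End_eqI[of _ p]) (use f g gf in \<open>simp_all add: Fp_End_apply\<close>)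
  moreover have "f \<otimes>\<^bsub>?V\<^esub> g = \<one>\<^bsub>?V\<^esub>"
    by (rule Fp_End_eqI[of _ p]) (use f g fg in \<open>simp_all add: Fp_End_apply\<close>)
  ultimately show ?thesis using f g by (auto simp: Units_def)
qed

end

context presemifield
begin

lemma right_zero: "x \<in> carrier S \<Longrightarrow> x \<otimes> \<zero> = \<zero>"
  using right_distrib[of \<zero> \<zero> x] mult_closed[of x \<zero>] by simp

lemma right_mult_in_Fp_End:
  "y \<in> carrier S \<Longrightarrow> (\<lambda>x\<in>carrier S. x \<otimes> y) \<in> carrier (Fp_End p S)"
  unfolding carrier_Fp_End by (auto simp: mult_closed left_distrib)

lemma spread_space: "spread_space (Fp_End p S) (spread_set S)"
proof -
  let ?V = "Fp_End p S"
  let ?r = "\<lambda>y. \<lambda>x\<in>carrier S. x \<otimes> y"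
  interpret V: ring ?V by (rule Fp_End_ring)
  note rV = right_mult_in_Fp_End[of _ p]
  have r_zero: "?r \<zero> = \<zero>\<^bsub>?V\<^esub>"
    by (auto simp: Fp_End_ops right_zero)
  have r_add: "?r y \<oplus>\<^bsub>?V\<^esub> ?r z = ?r (y \<oplus> z)" if "y \<in> carrier S" "z \<in> carrier S" for y z
    using that by (auto simp: Fp_End_ops right_distrib)
  have r_minus: "\<ominus>\<^bsub>?V\<^esub> (?r y) = ?r (\<ominus> y)" if y: "y \<in> carrier S" for y
    using r_add[of "\<ominus> y" y] y by (intro V.minus_equality) (auto simp: l_neg r_zero rV)
  have r_nonzero: "?r y \<noteq> \<zero>\<^bsub>?V\<^esub>" if y: "y \<in> carrier S" "y \<noteq> \<zero>" for y
  proof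
    assume "?r y = \<zero>\<^bsub>?V\<^esub>"
    then have "?r y y = \<zero>\<^bsub>?V\<^esub> y" by simp
    then have "y \<otimes> y = \<zero>" using y by (simp add: Fp_End_ops)
    then show False using no_zero_divisors[of y y] y by blast
  qed
  show ?thesis
  proof (intro spread_space.intro spread_space_axioms.intro Fp_End_ring)
    show "finite (carrier ?V)" using finite_carrier by (rule Fp_End_finite)
    show "spread_set S \<subseteq> carrier ?V" using rV by (auto simp: spread_set_def)
    show "\<zero>\<^bsub>?V\<^esub> \<in> spread_set S"
      unfolding spread_set_def by (rule image_eqI[of _ _ \<zero>]) (simp_all add: r_zero)
    show "c \<oplus>\<^bsub>?V\<^esub> d \<in> spread_set S" if "c \<in> spread_set S" "d \<in> spread_set S" for c d
      using that unfolding spread_set_def by (auto simp: r_add simp del: restrict_apply)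
    show "\<ominus>\<^bsub>?V\<^esub> c \<in> spread_set S" if "c \<in> spread_set S" for c
      using that unfolding spread_set_def by (auto simp: r_minus simp del: restrict_apply)
    obtain y where y: "y \<in> carrier S" "y \<noteq> \<zero>" using nontrivial zero_closed by blast
    then have "?r y \<in> spread_set S" by (auto simp: spread_set_def)
    with r_nonzero[OF y] show "spread_set S \<noteq> {\<zero>\<^bsub>?V\<^esub>}" by blast
    show "c \<in> Units ?V" if c: "c \<in> spread_set S" "c \<noteq> \<zero>\<^bsub>?V\<^esub>" for c
    proof -
      obtain y where y: "y \<in> carrier S" "c = ?r y" using c by (auto simp: spread_set_def)
      then have "y \<noteq> \<zero>" using c r_zero by auto
      then have "bij_betw c (carrier S) (carrier S)"
        using bij_right_mult[OF y(1)] y(2) bij_betw_cong[of "carrier S" c "\<lambda>x. x \<otimes> y"] by simp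
      then show ?thesis using Fp_End_Units rV y by blast
    qed
  qed
qed

end

section \<open>Right multiplications of an isotopic semifield\<close>

lemma dual_simps [simp]:
  "carrier (dual S) = carrier S" "x \<oplus>\<^bsub>dual S\<^esub> y = x \<oplus>\<^bsub>S\<^esub> y"
  "x \<otimes>\<^bsub>dual S\<^esub> y = y \<otimes>\<^bsub>S\<^esub> x" "\<one>\<^bsub>dual S\<^esub> = \<one>\<^bsub>S\<^esub>" "\<zero>\<^bsub>dual S\<^esub> = \<zero>\<^bsub>S\<^esub>"
  "[k] \<cdot>\<^bsub>dual S\<^esub> x = [k] \<cdot>\<^bsub>S\<^esub> x"
  for k :: nat
  by (simp_all add: dual_def add_pow_def)

lemma Fp_linear_dual [simp]: "Fp_linear p (dual S) (dual T) f = Fp_linear p S T f"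
  by (simp add: Fp_linear_def)

lemma Fp_End_dual [simp]: "Fp_End p (dual S) = Fp_End p S"
  by (simp add: Fp_End_def)

lemma right_nucleus_dual: "right_nucleus (dual T) = left_nucleus T"
  by (auto simp: right_nucleus_def left_nucleus_def)

lemma (in semifield) semifield_dual: "semifield (dual S)"
  using presemifield_dual one_in_carrier left_one right_one
  by (intro semifield.intro semifield_axioms.intro) auto

text \<open>
  Reversing the products exchanges the first two components of the isotopism.
\<close>

lemma isotopic_dual:
  assumes "isotopic p S T"
  shows "isotopic p (dual S) (dual T)"
proof -
  obtain g1 g2 g3 where g: "\<forall>g\<in>{g1, g2, g3}. Fp_linear p S T g \<and> bij_betw g (carrier S) (carrier T)"
    and iso: "\<forall>x\<in>carrier S. \<forall>y\<in>carrier S. g1 x \<otimes>\<^bsub>T\<^esub> g2 y = g3 (x \<otimes>\<^bsub>S\<^esub> y)"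
    and char: "has_characteristic S p" "has_characteristic T p"
    using assms unfolding isotopic_def by blast
  show ?thesis
    unfolding isotopic_def
  proof (intro conjI exI)
    show "\<forall>g\<in>{g2, g1, g3}. Fp_linear p (dual S) (dual T) g
        \<and> bij_betw g (carrier (dual S)) (carrier (dual T))"
      using g by auto
    show "\<forall>x\<in>carrier (dual S). \<forall>y\<in>carrier (dual S).
        g2 x \<otimes>\<^bsub>dual T\<^esub> g1 y = g3 (x \<otimes>\<^bsub>dual S\<^esub> y)"
      using iso by simp
  qed (use char in \<open>simp_all add: has_characteristic_def\<close>)
qed

text \<open>
  The map \<open>g\<close> identifies the additive group of a semifield \<open>T\<close> with that of \<open>S\<close>.  In the
  application it is the third component of an isotopism.
\<close>

locale semifield_coordinates = S: presemifield S + T: semifield T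
  for S :: "('a, 'm) ring_scheme" and T :: "('b, 'n) ring_scheme" +
  fixes p :: nat and g
  assumes g_bij: "bij_betw g (carrier S) (carrier T)"
    and g_add: "\<lbrakk>x \<in> carrier S; y \<in> carrier S\<rbrakk> \<Longrightarrow> g (x \<oplus>\<^bsub>S\<^esub> y) = g x \<oplus>\<^bsub>T\<^esub> g y"
begin

abbreviation "V \<equiv> Fp_End p S"

text \<open>
  Right multiplication by \<open>c\<close> in \<open>T\<close>, carried to \<open>S\<close> along \<open>g\<close>.
\<close>

definition coord :: "'b \<Rightarrow> 'a \<Rightarrow> 'a" where
  "coord c = (\<lambda>x\<in>carrier S. inv_into (carrier S) g (g x \<otimes>\<^bsub>T\<^esub> c))"

lemma g_closed: "x \<in> carrier S \<Longrightarrow> g x \<in> carrier T"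
  using g_bij bij_betwE by blast

lemma g_inject: "\<lbrakk>x \<in> carrier S; y \<in> carrier S; g x = g y\<rbrakk> \<Longrightarrow> x = y"
  using g_bij unfolding bij_betw_def inj_on_def by blast

lemma g_surj: "t \<in> carrier T \<Longrightarrow> \<exists>x\<in>carrier S. g x = t"
  using bij_betw_imp_surj_on[OF g_bij] by (metis imageE)

lemma coord_closed: "c \<in> carrier T \<Longrightarrow> x \<in> carrier S \<Longrightarrow> coord c x \<in> carrier S"
  using g_bij T.mult_closed[OF g_closed, of x c] inv_into_into[of "g x \<otimes>\<^bsub>T\<^esub> c" g "carrier S"]
  by (simp add: coord_def bij_betw_def)

lemma g_coord: "c \<in> carrier T \<Longrightarrow> x \<in> carrier S \<Longrightarrow> g (coord c x) = g x \<otimes>\<^bsub>T\<^esub> c"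
  using T.mult_closed[OF g_closed, of x c] bij_betw_inv_into_right[OF g_bij]
  by (simp add: coord_def)

lemma coord_in: "c \<in> carrier T \<Longrightarrow> coord c \<in> carrier V"
proof -
  assume c: "c \<in> carrier T"
  have "coord c (x \<oplus>\<^bsub>S\<^esub> y) = coord c x \<oplus>\<^bsub>S\<^esub> coord c y"
    if "x \<in> carrier S" "y \<in> carrier S" for x y
    using that c
    by (intro g_inject) (simp_all add: coord_closed g_coord g_add g_closed T.left_distrib)
  then show ?thesis
    unfolding S.carrier_Fp_End using coord_closed[OF c] by (simp add: coord_def)
qed

lemma eq_coordI:
  assumes "f \<in> carrier V" "c \<in> carrier T" "\<And>x. x \<in> carrier S \<Longrightarrow> g (f x) = g x \<otimes>\<^bsub>T\<^esub> c"
  shows "f = coord c"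
  by (rule S.Fp_End_eqI[OF assms(1) coord_in[OF assms(2)]], rule g_inject)
     (use assms in \<open>simp_all add: coord_closed g_coord S.Fp_End_closed\<close>)

interpretation V: ring V by (rule S.Fp_End_ring)

lemma coord_one: "coord \<one>\<^bsub>T\<^esub> = \<one>\<^bsub>V\<^esub>"
  by (rule eq_coordI[symmetric])
     (simp_all add: T.one_in_carrier S.Fp_End_apply T.right_one g_closed)

lemma coord_add:
  assumes "b \<in> carrier T" "c \<in> carrier T"
  shows "coord (b \<oplus>\<^bsub>T\<^esub> c) = coord b \<oplus>\<^bsub>V\<^esub> coord c"
  by (rule eq_coordI[symmetric])
     (use assms in \<open>simp_all add: coord_in S.Fp_End_apply g_add coord_closed g_coord
        g_closed T.right_distrib\<close>)

lemma coord_inj: "inj_on coord (carrier T)"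
proof (rule inj_onI)
  fix b c assume bc: "b \<in> carrier T" "c \<in> carrier T" and eq: "coord b = coord c"
  obtain e where e: "e \<in> carrier S" "g e = \<one>\<^bsub>T\<^esub>"
    using g_surj[OF T.one_in_carrier] by blast
  have "b = g (coord b e)" using bc e by (simp add: g_coord T.left_one)
  also have "\<dots> = g (coord c e)" by (simp only: eq)
  also have "\<dots> = c" using bc e by (simp add: g_coord T.left_one)
  finally show "b = c" .
qed

lemma g_coord_mult:
  assumes "b \<in> carrier T" "c \<in> carrier T" "x \<in> carrier S"
  shows "g ((coord b \<otimes>\<^bsub>V\<^esub> coord c) x) = (g x \<otimes>\<^bsub>T\<^esub> c) \<otimes>\<^bsub>T\<^esub> b"
  using assms by (simp add: S.Fp_End_apply g_coord coord_closed)

lemma coord_mult: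
  assumes "b \<in> carrier T" "c \<in> carrier T"
    and "\<And>t. t \<in> carrier T \<Longrightarrow> (t \<otimes>\<^bsub>T\<^esub> c) \<otimes>\<^bsub>T\<^esub> b = t \<otimes>\<^bsub>T\<^esub> (c \<otimes>\<^bsub>T\<^esub> b)"
  shows "coord b \<otimes>\<^bsub>V\<^esub> coord c = coord (c \<otimes>\<^bsub>T\<^esub> b)"
  by (rule eq_coordI)
     (use assms in \<open>simp_all add: coord_in g_coord_mult g_closed T.mult_closed\<close>)

abbreviation "D \<equiv> coord ` carrier T"

text \<open>
  If the product of two right multiplications is a right multiplication at all, its multiplier is
  found by evaluation at the identity of \<open>T\<close>; what remains is an associative law.  Quantified over
  \<open>c\<close>, this law defines the right nucleus, quantified over \<open>b\<close> the middle one.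
\<close>

lemma coord_mult_mem:
  assumes bc: "b \<in> carrier T" "c \<in> carrier T"
  shows "coord b \<otimes>\<^bsub>V\<^esub> coord c \<in> D \<longleftrightarrow>
    (\<forall>t\<in>carrier T. (t \<otimes>\<^bsub>T\<^esub> c) \<otimes>\<^bsub>T\<^esub> b = t \<otimes>\<^bsub>T\<^esub> (c \<otimes>\<^bsub>T\<^esub> b))"
proof
  assume "coord b \<otimes>\<^bsub>V\<^esub> coord c \<in> D"
  then obtain d where d: "d \<in> carrier T" "coord b \<otimes>\<^bsub>V\<^esub> coord c = coord d" by blast
  have eq: "(t \<otimes>\<^bsub>T\<^esub> c) \<otimes>\<^bsub>T\<^esub> b = t \<otimes>\<^bsub>T\<^esub> d" if t: "t \<in> carrier T" for t
  proof -
    obtain x where x: "x \<in> carrier S" "g x = t" using g_surj[OF t] by blast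
    show ?thesis using g_coord_mult[OF bc x(1)] g_coord[OF d(1) x(1)] by (simp add: d(2) x)
  qed
  from eq[OF T.one_in_carrier] have "c \<otimes>\<^bsub>T\<^esub> b = d" using bc d by (simp add: T.left_one)
  with eq show "\<forall>t\<in>carrier T. (t \<otimes>\<^bsub>T\<^esub> c) \<otimes>\<^bsub>T\<^esub> b = t \<otimes>\<^bsub>T\<^esub> (c \<otimes>\<^bsub>T\<^esub> b)" by simp
next
  assume "\<forall>t\<in>carrier T. (t \<otimes>\<^bsub>T\<^esub> c) \<otimes>\<^bsub>T\<^esub> b = t \<otimes>\<^bsub>T\<^esub> (c \<otimes>\<^bsub>T\<^esub> b)"
  then have "coord b \<otimes>\<^bsub>V\<^esub> coord c = coord (c \<otimes>\<^bsub>T\<^esub> b)" using bc by (intro coord_mult) auto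
  then show "coord b \<otimes>\<^bsub>V\<^esub> coord c \<in> D" using bc T.mult_closed by auto
qed

lemma one_in_D: "\<one>\<^bsub>V\<^esub> \<in> D"
  using coord_one T.one_in_carrier by (metis imageI)

text \<open>
  As \<open>D\<close> contains the identity map, an element of its left idealizer belongs to \<open>D\<close> itself.
\<close>

lemma coord_right_nucleus: "coord ` right_nucleus T = left_idealizer V D"
proof (intro equalityI subsetI)
  fix f assume "f \<in> coord ` right_nucleus T"
  then obtain b where b: "b \<in> right_nucleus T" "f = coord b" by blast
  then show "f \<in> left_idealizer V D"
    by (auto simp: left_idealizer_def right_nucleus_def coord_in coord_mult_mem)
next
  fix f assume f: "f \<in> left_idealizer V D"
  then have "f \<otimes>\<^bsub>V\<^esub> \<one>\<^bsub>V\<^esub> \<in> D" "f \<in> carrier V"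
    using one_in_D unfolding left_idealizer_def by blast+
  then obtain b where b: "b \<in> carrier T" "f = coord b" by auto
  have "coord b \<otimes>\<^bsub>V\<^esub> coord c \<in> D" if "c \<in> carrier T" for c
    using f that b unfolding left_idealizer_def by blast
  then have "b \<in> right_nucleus T" using b by (auto simp: right_nucleus_def coord_mult_mem)
  with b show "f \<in> coord ` right_nucleus T" by blast
qed

lemma coord_middle_nucleus: "coord ` middle_nucleus T = right_idealizer V D"
proof (intro equalityI subsetI)
  fix f assume "f \<in> coord ` middle_nucleus T"
  then obtain b where b: "b \<in> middle_nucleus T" "f = coord b" by blast
  then show "f \<in> right_idealizer V D"
    by (auto simp: right_idealizer_def middle_nucleus_def coord_in coord_mult_mem)
next
  fix f assume f: "f \<in> right_idealizer V D"
  then have "\<one>\<^bsub>V\<^esub> \<otimes>\<^bsub>V\<^esub> f \<in> D" "f \<in> carrier V"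
    using one_in_D unfolding right_idealizer_def by blast+
  then obtain b where b: "b \<in> carrier T" "f = coord b" by auto
  have "coord c \<otimes>\<^bsub>V\<^esub> coord b \<in> D" if "c \<in> carrier T" for c
    using f that b unfolding right_idealizer_def by blast
  then have "b \<in> middle_nucleus T" using b by (auto simp: middle_nucleus_def coord_mult_mem)
  with b show "f \<in> coord ` middle_nucleus T" by blast
qed

lemma coord_commute_iff:
  assumes ab: "a \<in> carrier T" "b \<in> carrier T"
  shows "coord a \<otimes>\<^bsub>V\<^esub> coord b = coord b \<otimes>\<^bsub>V\<^esub> coord a \<longleftrightarrow>
    (\<forall>t\<in>carrier T. (t \<otimes>\<^bsub>T\<^esub> b) \<otimes>\<^bsub>T\<^esub> a = (t \<otimes>\<^bsub>T\<^esub> a) \<otimes>\<^bsub>T\<^esub> b)" (is "?l \<longleftrightarrow> ?r")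
proof
  assume ?l
  show ?r
  proof
    fix t assume "t \<in> carrier T"
    then obtain x where x: "x \<in> carrier S" "g x = t" using g_surj by blast
    show "(t \<otimes>\<^bsub>T\<^esub> b) \<otimes>\<^bsub>T\<^esub> a = (t \<otimes>\<^bsub>T\<^esub> a) \<otimes>\<^bsub>T\<^esub> b"
      using g_coord_mult[OF ab x(1)] g_coord_mult[OF ab(2,1) x(1)] \<open>?l\<close> x by simp
  qed
next
  assume ?r
  have cl: "coord a \<otimes>\<^bsub>V\<^esub> coord b \<in> carrier V" "coord b \<otimes>\<^bsub>V\<^esub> coord a \<in> carrier V"
    using ab coord_in by simp_all
  show ?l
  proof (rule S.Fp_End_eqI[OF cl], rule g_inject)
    fix x assume x: "x \<in> carrier S"
    show "g ((coord a \<otimes>\<^bsub>V\<^esub> coord b) x) = g ((coord b \<otimes>\<^bsub>V\<^esub> coord a) x)"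
      using \<open>?r\<close> ab x g_closed by (simp add: g_coord_mult)
  qed (use cl S.Fp_End_closed in blast)+
qed

text \<open>
  An element \<open>a\<close> of the right nucleus whose multiplication commutes with all others satisfies
  \<open>(t b) a = (t a) b\<close>.  At \<open>t = 1\<close> this is commutativity, which then turns the associative law of the
  right nucleus into those of the middle and the left nucleus.
\<close>

lemma coord_center: "coord ` semifield_center T = left_central V D \<one>\<^bsub>V\<^esub>"
proof -
  have one: "conj_by V \<one>\<^bsub>V\<^esub> f = f" if "f \<in> carrier V" for f
    using that by (simp add: conj_by_def)
  have "a \<in> semifield_center T \<longleftrightarrow> a \<in> right_nucleus T \<and>
      (\<forall>b\<in>carrier T. coord a \<otimes>\<^bsub>V\<^esub> coord b = coord b \<otimes>\<^bsub>V\<^esub> coord a)" for a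
  proof
    assume a: "a \<in> semifield_center T"
    then have ac: "a \<in> carrier T" and comm: "\<And>b. b \<in> carrier T \<Longrightarrow> a \<otimes>\<^bsub>T\<^esub> b = b \<otimes>\<^bsub>T\<^esub> a"
      and r: "a \<in> right_nucleus T" and m: "a \<in> middle_nucleus T"
      by (auto simp: semifield_center_def left_nucleus_def)
    have "(t \<otimes>\<^bsub>T\<^esub> b) \<otimes>\<^bsub>T\<^esub> a = (t \<otimes>\<^bsub>T\<^esub> a) \<otimes>\<^bsub>T\<^esub> b" if "t \<in> carrier T" "b \<in> carrier T" for t b
      using r m that comm[OF that(2)] by (simp add: right_nucleus_def middle_nucleus_def)
    with r ac show "a \<in> right_nucleus T \<and>
        (\<forall>b\<in>carrier T. coord a \<otimes>\<^bsub>V\<^esub> coord b = coord b \<otimes>\<^bsub>V\<^esub> coord a)"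
      by (simp add: coord_commute_iff)
  next
    assume a: "a \<in> right_nucleus T \<and>
        (\<forall>b\<in>carrier T. coord a \<otimes>\<^bsub>V\<^esub> coord b = coord b \<otimes>\<^bsub>V\<^esub> coord a)"
    then have ac: "a \<in> carrier T"
      and r: "\<And>x y. \<lbrakk>x \<in> carrier T; y \<in> carrier T\<rbrakk> \<Longrightarrow> (x \<otimes>\<^bsub>T\<^esub> y) \<otimes>\<^bsub>T\<^esub> a = x \<otimes>\<^bsub>T\<^esub> (y \<otimes>\<^bsub>T\<^esub> a)"
      by (auto simp: right_nucleus_def)
    have swap: "(t \<otimes>\<^bsub>T\<^esub> b) \<otimes>\<^bsub>T\<^esub> a = (t \<otimes>\<^bsub>T\<^esub> a) \<otimes>\<^bsub>T\<^esub> b" if "t \<in> carrier T" "b \<in> carrier T" for t b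
      using a ac that by (simp add: coord_commute_iff)
    have comm: "a \<otimes>\<^bsub>T\<^esub> b = b \<otimes>\<^bsub>T\<^esub> a" if "b \<in> carrier T" for b
      using swap[OF T.one_in_carrier that] ac that by (simp add: T.left_one)
    have m: "(x \<otimes>\<^bsub>T\<^esub> a) \<otimes>\<^bsub>T\<^esub> y = x \<otimes>\<^bsub>T\<^esub> (a \<otimes>\<^bsub>T\<^esub> y)" if "x \<in> carrier T" "y \<in> carrier T" for x y
      using swap[OF that] r[OF that] comm[OF that(2)] by simp
    have l: "(a \<otimes>\<^bsub>T\<^esub> x) \<otimes>\<^bsub>T\<^esub> y = a \<otimes>\<^bsub>T\<^esub> (x \<otimes>\<^bsub>T\<^esub> y)" if "x \<in> carrier T" "y \<in> carrier T" for x y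
      using swap[OF that] comm[OF that(1)] comm[OF T.mult_closed[OF that]] by simp
    show "a \<in> semifield_center T"
      using ac r m l comm
      by (auto simp: semifield_center_def left_nucleus_def middle_nucleus_def right_nucleus_def)
  qed
  note center_iff = this
  have "coord a \<in> left_central V D \<one>\<^bsub>V\<^esub> \<longleftrightarrow> coord a \<in> left_idealizer V D \<and>
      (\<forall>b\<in>carrier T. coord a \<otimes>\<^bsub>V\<^esub> coord b = coord b \<otimes>\<^bsub>V\<^esub> coord a)" for a
    by (auto simp: left_central_def left_idealizer_def one)
  note central_iff = this
  show ?thesis
  proof (intro equalityI subsetI)
    fix f assume "f \<in> coord ` semifield_center T"
    then show "f \<in> left_central V D \<one>\<^bsub>V\<^esub>"
      using center_iff central_iff coord_right_nucleus by blast
  next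
    fix f assume f: "f \<in> left_central V D \<one>\<^bsub>V\<^esub>"
    then have "f \<in> left_idealizer V D" by (simp add: left_central_def)
    then obtain a where "a \<in> right_nucleus T" "f = coord a"
      using coord_right_nucleus by blast
    with f show "f \<in> coord ` semifield_center T"
      using center_iff central_iff by blast
  qed
qed

text \<open>
  The map \<open>coord\<close> reverses products, but its image here is commutative.  So it is an isomorphism
  for the multiplication of \<open>T\<close> and also for the opposite one; the latter is what transfers
  the result on right nuclei to left nuclei.
\<close>

lemma coord_iso:
  assumes N: "N \<subseteq> carrier T" and field: "field (V\<lparr>carrier := coord ` N\<rparr>)"
    and assoc: "\<And>b c t. \<lbrakk>b \<in> N; c \<in> N; t \<in> carrier T\<rbrakk>
      \<Longrightarrow> (t \<otimes>\<^bsub>T\<^esub> c) \<otimes>\<^bsub>T\<^esub> b = t \<otimes>\<^bsub>T\<^esub> (c \<otimes>\<^bsub>T\<^esub> b)"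
  shows "T\<lparr>carrier := N\<rparr> \<simeq> V\<lparr>carrier := coord ` N\<rparr>"
    and "(dual T)\<lparr>carrier := N\<rparr> \<simeq> V\<lparr>carrier := coord ` N\<rparr>"
proof -
  interpret F: field "V\<lparr>carrier := coord ` N\<rparr>" by fact
  have Nc: "b \<in> carrier T" if "b \<in> N" for b using N that by blast
  have comm: "coord b \<otimes>\<^bsub>V\<^esub> coord c = coord c \<otimes>\<^bsub>V\<^esub> coord b" if "b \<in> N" "c \<in> N" for b c
    using F.m_comm that by simp
  have mult: "coord b \<otimes>\<^bsub>V\<^esub> coord c = coord (c \<otimes>\<^bsub>T\<^esub> b)" if "b \<in> N" "c \<in> N" for b c
    using that by (intro coord_mult) (simp_all add: Nc assoc)
  have mult': "coord (b \<otimes>\<^bsub>T\<^esub> c) = coord b \<otimes>\<^bsub>V\<^esub> coord c" if "b \<in> N" "c \<in> N" for b c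
    using mult[OF that(2,1)] comm[OF that] by simp
  have bij: "bij_betw coord N (coord ` N)"
    using inj_on_subset[OF coord_inj N] by (simp add: bij_betw_def)
  have "coord \<in> ring_hom (T\<lparr>carrier := N\<rparr>) (V\<lparr>carrier := coord ` N\<rparr>)"
    by (rule ring_hom_memI) (simp_all add: Nc coord_add coord_one mult')
  with bij have "coord \<in> ring_iso (T\<lparr>carrier := N\<rparr>) (V\<lparr>carrier := coord ` N\<rparr>)"
    by (simp add: ring_iso_def)
  then show "T\<lparr>carrier := N\<rparr> \<simeq> V\<lparr>carrier := coord ` N\<rparr>"
    unfolding is_ring_iso_def by blast
  have "coord \<in> ring_hom ((dual T)\<lparr>carrier := N\<rparr>) (V\<lparr>carrier := coord ` N\<rparr>)"
    by (rule ring_hom_memI) (simp_all add: Nc coord_add coord_one mult dual_def)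
  with bij have "coord \<in> ring_iso ((dual T)\<lparr>carrier := N\<rparr>) (V\<lparr>carrier := coord ` N\<rparr>)"
    by (simp add: ring_iso_def)
  then show "(dual T)\<lparr>carrier := N\<rparr> \<simeq> V\<lparr>carrier := coord ` N\<rparr>"
    unfolding is_ring_iso_def by blast
qed

end

text \<open>
  Put \<open>h = g1\<^sup>-\<^sup>1 g3\<close>.  Then \<open>g3 (h x \<star> y) = g1 (h x) \<star> g2 y = g3 x \<star> g2 y\<close>, so right multiplication by \<open>y\<close>
  in \<open>S\<close> after \<open>h\<close> is right multiplication by \<open>g2 y\<close> in \<open>T\<close>, carried over along \<open>g3\<close>.
\<close>

lemma isotopic_coordinates:
  assumes S: "presemifield S" and T: "semifield T" and iso: "isotopic p S T"
  obtains g h where "semifield_coordinates S T g" and "h \<in> Units (Fp_End p S)"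
    and "semifield_coordinates.coord S T g ` carrier T = translate (Fp_End p S) (spread_set S) h"
proof -
  let ?V = "Fp_End p S"
  interpret S: presemifield S by fact
  interpret T: semifield T by fact
  interpret V: ring ?V by (rule S.Fp_End_ring)
  obtain g1 g2 g3 where g: "\<forall>g\<in>{g1, g2, g3}. Fp_linear p S T g \<and> bij_betw g (carrier S) (carrier T)"
    and iso: "\<And>x y. \<lbrakk>x \<in> carrier S; y \<in> carrier S\<rbrakk> \<Longrightarrow> g1 x \<otimes>\<^bsub>T\<^esub> g2 y = g3 (x \<otimes>\<^bsub>S\<^esub> y)"
    using iso unfolding isotopic_def by blast
  have add: "g (x \<oplus>\<^bsub>S\<^esub> y) = g x \<oplus>\<^bsub>T\<^esub> g y"
    if "g \<in> {g1, g2, g3}" "x \<in> carrier S" "y \<in> carrier S" for g x y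
    using g that unfolding Fp_linear_def by blast
  have bij1: "bij_betw g1 (carrier S) (carrier T)" and bij2: "bij_betw g2 (carrier S) (carrier T)"
    and bij3: "bij_betw g3 (carrier S) (carrier T)" using g by auto
  interpret c1: semifield_coordinates S T p g1
    by unfold_locales (use bij1 add in auto)
  interpret c3: semifield_coordinates S T p g3
    by unfold_locales (use bij3 add in auto)
  define h where "h = (\<lambda>x\<in>carrier S. inv_into (carrier S) g1 (g3 x))"
  have g1h: "g1 (h x) = g3 x" if "x \<in> carrier S" for x
    using bij_betw_inv_into_right[OF bij1 c3.g_closed[OF that]] that by (simp add: h_def)
  have hbij: "bij_betw h (carrier S) (carrier S)"
    using bij_betw_trans[OF bij3 bij_betw_inv_into[OF bij1]]
      bij_betw_cong[of "carrier S" h "inv_into (carrier S) g1 \<circ> g3"] by (simp add: h_def)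
  have hc: "h x \<in> carrier S" if "x \<in> carrier S" for x using hbij that by (rule bij_betw_apply)
  have "h (x \<oplus>\<^bsub>S\<^esub> y) = h x \<oplus>\<^bsub>S\<^esub> h y" if "x \<in> carrier S" "y \<in> carrier S" for x y
    using that by (intro c1.g_inject) (simp_all add: hc g1h c1.g_add c3.g_add)
  then have hV: "h \<in> carrier ?V"
    unfolding S.carrier_Fp_End using hc by (simp add: h_def)
  have hU: "h \<in> Units ?V" using S.Fp_End_Units[OF hV hbij] .
  have key: "(\<lambda>x\<in>carrier S. x \<otimes>\<^bsub>S\<^esub> y) \<otimes>\<^bsub>?V\<^esub> h = c3.coord (g2 y)" if y: "y \<in> carrier S" for y
  proof (rule c3.eq_coordI)
    show "(\<lambda>x\<in>carrier S. x \<otimes>\<^bsub>S\<^esub> y) \<otimes>\<^bsub>?V\<^esub> h \<in> carrier ?V"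
      using S.right_mult_in_Fp_End[OF y] hV by simp
    show "g2 y \<in> carrier T" using bij2 y by (rule bij_betw_apply)
    show "g3 (((\<lambda>x\<in>carrier S. x \<otimes>\<^bsub>S\<^esub> y) \<otimes>\<^bsub>?V\<^esub> h) x) = g3 x \<otimes>\<^bsub>T\<^esub> g2 y"
      if "x \<in> carrier S" for x
      using that y hc iso[OF hc y] by (simp add: S.Fp_End_apply g1h)
  qed
  have "translate ?V (spread_set S) h = c3.coord ` g2 ` carrier S"
    unfolding translate_def spread_set_def image_image by (rule image_cong) (simp_all add: key)
  also have "g2 ` carrier S = carrier T" using bij2 by (rule bij_betw_imp_surj_on)
  finally show thesis using that[OF c3.semifield_coordinates_axioms hU] by simp
qed

section \<open>Nuclei and center of isotopic semifields\<close>

context presemifield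
begin

interpretation sp: spread_space "Fp_End p S" "spread_set S" for p
  by (rule spread_space)

lemma Nr_cond_iff:
  "Nr_cond p S F \<longleftrightarrow> field_contained_in (Fp_End p S) F \<and>
     F \<subseteq> left_idealizer (Fp_End p S) (spread_set S)"
proof -
  have "F <#>\<^bsub>Fp_End p S\<^esub> spread_set S \<subseteq> spread_set S \<longleftrightarrow>
      F \<subseteq> left_idealizer (Fp_End p S) (spread_set S)"
    if "F \<subseteq> carrier (Fp_End p S)"
    using that by (auto simp: set_mult_def left_idealizer_def)
  then show ?thesis unfolding Nr_cond_def field_contained_in_def by metis
qed

lemma Nm_cond_iff:
  "Nm_cond p S F \<longleftrightarrow> field_contained_in (Fp_End p S) F \<and>
     F \<subseteq> right_idealizer (Fp_End p S) (spread_set S)"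
proof -
  have "spread_set S <#>\<^bsub>Fp_End p S\<^esub> F \<subseteq> spread_set S \<longleftrightarrow>
      F \<subseteq> right_idealizer (Fp_End p S) (spread_set S)"
    if "F \<subseteq> carrier (Fp_End p S)"
    using that by (auto simp: set_mult_def right_idealizer_def)
  then show ?thesis unfolding Nm_cond_def field_contained_in_def by metis
qed

lemma idealizer_subset:
  "left_idealizer (Fp_End p S) (spread_set S) \<subseteq> carrier (Fp_End p S)"
  "right_idealizer (Fp_End p S) (spread_set S) \<subseteq> carrier (Fp_End p S)"
  by (auto simp: left_idealizer_def right_idealizer_def)

lemma Nr_largest: "is_largest (Nr_cond p S) (Nr p S)"
  and Nr_eq: "Nr p S = left_idealizer (Fp_End p S) (spread_set S)"
  using sp.greatest_field[OF idealizer_subset(1) sp.left_idealizer_field Nr_cond_iff]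
  by (simp_all add: Nr_def)

lemma Nm_largest: "is_largest (Nm_cond p S) (Nm p S)"
  and Nm_eq: "Nm p S = right_idealizer (Fp_End p S) (spread_set S)"
  using sp.greatest_field[OF idealizer_subset(2) sp.right_idealizer_field Nm_cond_iff]
  by (simp_all add: Nm_def)

lemma Kr_cond_iff:
  "Kr_cond p S w F \<longleftrightarrow> field_contained_in (Fp_End p S) F \<and>
     F \<subseteq> left_central (Fp_End p S) (spread_set S) w"
  unfolding Kr_cond_def Nr_eq by (auto simp: left_central_def conj_by_def)

lemma Km_cond_iff:
  assumes "s \<in> Units (Fp_End p S)"
  shows "Km_cond p S s F \<longleftrightarrow> field_contained_in (Fp_End p S) F \<and>
     F \<subseteq> right_central (Fp_End p S) (spread_set S) s"
  unfolding Km_cond_def Nm_eq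
  by (auto simp: right_central_def conj_by_def sp.Units_inv_inv[OF assms])

lemma central_subset:
  "left_central (Fp_End p S) (spread_set S) w \<subseteq> carrier (Fp_End p S)"
  "right_central (Fp_End p S) (spread_set S) w \<subseteq> carrier (Fp_End p S)"
  using idealizer_subset[of p] by (auto simp: left_central_def right_central_def)

lemma
  assumes w: "w \<in> Units (Fp_End p S)"
  shows Kr_largest: "is_largest (Kr_cond p S w) (Kr p S w)"
    and Kr_eq: "Kr p S w = left_central (Fp_End p S) (spread_set S) w"
  using sp.greatest_field[OF central_subset(1) sp.left_central_field[OF w] Kr_cond_iff]
  by (simp_all add: Kr_def)

lemma
  assumes s: "s \<in> Units (Fp_End p S)"
  shows Km_largest: "is_largest (Km_cond p S s) (Km p S s)"
    and Km_eq: "Km p S s = right_central (Fp_End p S) (spread_set S) s"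
  using sp.greatest_field[OF central_subset(2) sp.right_central_field[OF s] Km_cond_iff[OF s]]
  by (simp_all add: Km_def)

end

text \<open>
  The nuclei of \<open>T\<close> are idealizers of the translate \<open>C h\<close>, and the behavior of idealizers under
  translation leads back to \<open>C\<close>.
\<close>

lemma nuclei_of_isotopic_semifield:
  fixes S :: "('a, 'm) ring_scheme" and T :: "('b, 'n) ring_scheme"
  assumes S: "presemifield S" and T: "semifield T" and iso: "isotopic p S T"
  defines "V \<equiv> Fp_End p S" and "C \<equiv> spread_set S"
  shows right_nucleus_iso: "T\<lparr>carrier := right_nucleus T\<rparr> \<simeq> V\<lparr>carrier := left_idealizer V C\<rparr>"
    and dual_right_nucleus_iso:
      "(dual T)\<lparr>carrier := right_nucleus T\<rparr> \<simeq> V\<lparr>carrier := left_idealizer V C\<rparr>"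
    and middle_nucleus_iso:
      "T\<lparr>carrier := middle_nucleus T\<rparr> \<simeq> V\<lparr>carrier := right_idealizer V C\<rparr>"
    and center_iso: "\<lbrakk>w \<in> C; w \<in> Units V\<rbrakk> \<Longrightarrow>
      T\<lparr>carrier := semifield_center T\<rparr> \<simeq> V\<lparr>carrier := left_central V C w\<rparr>"
proof -
  interpret sp: spread_space V C
    unfolding V_def C_def using S by (rule presemifield.spread_space)
  obtain g h where "semifield_coordinates S T g" and h: "h \<in> Units V"
    and D: "semifield_coordinates.coord S T g ` carrier T = translate V C h"
    using isotopic_coordinates[OF S T iso] unfolding V_def C_def .
  interpret co: semifield_coordinates S T p g by fact
  interpret D: spread_space V "translate V C h" by (rule sp.spread_space_translate[OF h])
  have right: "co.coord ` right_nucleus T = left_idealizer V C"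
    using co.coord_right_nucleus sp.left_idealizer_translate[OF h] D by (simp add: V_def)
  have middle: "co.coord ` middle_nucleus T = right_idealizer V (translate V C h)"
    using co.coord_middle_nucleus D by (simp add: V_def)
  have center: "co.coord ` semifield_center T = left_central V (translate V C h) \<one>\<^bsub>V\<^esub>"
    using co.coord_center D by (simp add: V_def)
  have rN: "right_nucleus T \<subseteq> carrier T" and mN: "middle_nucleus T \<subseteq> carrier T"
    and cN: "semifield_center T \<subseteq> carrier T"
    by (auto simp: right_nucleus_def middle_nucleus_def semifield_center_def)
  have right_assoc: "t \<otimes>\<^bsub>T\<^esub> c \<otimes>\<^bsub>T\<^esub> b = t \<otimes>\<^bsub>T\<^esub> (c \<otimes>\<^bsub>T\<^esub> b)"
    if "b \<in> right_nucleus T" "c \<in> right_nucleus T" "t \<in> carrier T" for b c t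
    using that by (simp add: right_nucleus_def)
  have "field (V\<lparr>carrier := co.coord ` right_nucleus T\<rparr>)"
    unfolding right by (rule sp.left_idealizer_field)
  note right_iso = co.coord_iso[OF rN this[unfolded V_def] right_assoc, folded V_def, unfolded right]
  show "T\<lparr>carrier := right_nucleus T\<rparr> \<simeq> V\<lparr>carrier := left_idealizer V C\<rparr>"
    and "(dual T)\<lparr>carrier := right_nucleus T\<rparr> \<simeq> V\<lparr>carrier := left_idealizer V C\<rparr>"
    using right_iso by blast+
  have middle_assoc: "t \<otimes>\<^bsub>T\<^esub> c \<otimes>\<^bsub>T\<^esub> b = t \<otimes>\<^bsub>T\<^esub> (c \<otimes>\<^bsub>T\<^esub> b)"
    if "b \<in> middle_nucleus T" "c \<in> middle_nucleus T" "t \<in> carrier T" for b c t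
    using that by (simp add: middle_nucleus_def)
  have "field (V\<lparr>carrier := co.coord ` middle_nucleus T\<rparr>)"
    unfolding middle by (rule D.right_idealizer_field)
  note middle_iso = co.coord_iso(1)[OF mN this[unfolded V_def] middle_assoc, folded V_def,
      unfolded middle]
  have "right_idealizer V (translate V C h) \<subseteq> carrier V"
    by (auto simp: right_idealizer_def)
  moreover have "conj_by V (inv\<^bsub>V\<^esub> h) ` right_idealizer V (translate V C h) = right_idealizer V C"
  proof -
    have "conj_by V (inv\<^bsub>V\<^esub> h) (conj_by V h f) = f" if "f \<in> right_idealizer V C" for f
      using that h by (intro sp.conj_by_inv) (simp_all add: right_idealizer_def)
    then show ?thesis by (simp add: sp.right_idealizer_translate[OF h] image_image)
  qed
  ultimately have "V\<lparr>carrier := right_idealizer V (translate V C h)\<rparr>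
      \<simeq> V\<lparr>carrier := right_idealizer V C\<rparr>"
    using sp.conj_by_iso[OF sp.Units_inv_Units[OF h]] by metis
  with middle_iso show "T\<lparr>carrier := middle_nucleus T\<rparr> \<simeq> V\<lparr>carrier := right_idealizer V C\<rparr>"
    by (rule ring_iso_trans)
  show "T\<lparr>carrier := semifield_center T\<rparr> \<simeq> V\<lparr>carrier := left_central V C w\<rparr>"
    if w: "w \<in> C" "w \<in> Units V"
  proof -
    \<comment> \<open>The element \<open>v = h\<^sup>-\<^sup>1\<close> of \<open>C\<close> is the one that the translation takes to the identity.\<close>
    have "\<one>\<^bsub>V\<^esub> \<in> translate V C h" using co.one_in_D D by (simp add: V_def)
    then obtain v where v: "v \<in> C" "v \<otimes>\<^bsub>V\<^esub> h = \<one>\<^bsub>V\<^esub>" by (auto simp: translate_def)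
    then have vU: "v \<in> Units V" using sp.one_not_zero sp.C_units h by (metis sp.Units_closed sp.l_null)
    have "left_central V (translate V C h) \<one>\<^bsub>V\<^esub> = left_central V C v"
      using sp.left_central_translate[OF h vU] v by simp
    also have "\<dots> = left_central V C w" by (rule sp.left_central_base_change[OF v(1) vU w])
    finally have image: "co.coord ` semifield_center T = left_central V C w" using center by simp
    have "field (V\<lparr>carrier := co.coord ` semifield_center T\<rparr>)"
      unfolding image by (rule sp.left_central_field[OF w(2)])
    moreover have "t \<otimes>\<^bsub>T\<^esub> c \<otimes>\<^bsub>T\<^esub> b = t \<otimes>\<^bsub>T\<^esub> (c \<otimes>\<^bsub>T\<^esub> b)"
      if "b \<in> semifield_center T" "c \<in> semifield_center T" "t \<in> carrier T" for b c t
      using that right_assoc by (simp add: semifield_center_def)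
    ultimately show ?thesis
      using co.coord_iso(1)[OF cN] image unfolding V_def by metis
  qed
qed

theorem theorem2p2:
  fixes S :: "('a, 'm) ring_scheme" and p :: nat
  assumes "presemifield S" and "has_characteristic S p"
  shows
    "(is_largest (Nr_cond p S) (Nr p S) \<and>
         (\<forall>T :: ('b, 'n) ring_scheme. semifield T \<and> isotopic p S T \<longrightarrow>
            T\<lparr>carrier := right_nucleus T\<rparr> \<simeq> (Fp_End p S)\<lparr>carrier := Nr p S\<rparr>)) \<and>
     (is_largest (Nm_cond p S) (Nm p S) \<and>
         (\<forall>T :: ('b, 'n) ring_scheme. semifield T \<and> isotopic p S T \<longrightarrow>
            T\<lparr>carrier := middle_nucleus T\<rparr> \<simeq> (Fp_End p S)\<lparr>carrier := Nm p S\<rparr>)) \<and>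
     (is_largest (Nl_cond p S) (Nl p S) \<and>
         (\<forall>T :: ('b, 'n) ring_scheme. semifield T \<and> isotopic p S T \<longrightarrow>
            T\<lparr>carrier := left_nucleus T\<rparr> \<simeq> (Fp_End p S)\<lparr>carrier := Nl p S\<rparr>)) \<and>
     (\<forall>\<omega> \<in> spread_set S \<inter> Units (Fp_End p S).
         is_largest (Kr_cond p S \<omega>) (Kr p S \<omega>) \<and>
         (\<forall>T :: ('b, 'n) ring_scheme. semifield T \<and> isotopic p S T \<longrightarrow>
            T\<lparr>carrier := semifield_center T\<rparr> \<simeq> (Fp_End p S)\<lparr>carrier := Kr p S \<omega>\<rparr>)) \<and>
     (\<forall>\<sigma> \<in> spread_set S \<inter> Units (Fp_End p S).
         is_largest (Km_cond p S \<sigma>) (Km p S \<sigma>) \<and>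
         (\<forall>T :: ('b, 'n) ring_scheme. semifield T \<and> isotopic p S T \<longrightarrow>
            T\<lparr>carrier := semifield_center T\<rparr> \<simeq> (Fp_End p S)\<lparr>carrier := Km p S \<sigma>\<rparr>)) \<and>
     (\<forall>\<omega> \<in> spread_set S \<inter> Units (Fp_End p S).
         \<forall>\<sigma> \<in> spread_set S \<inter> Units (Fp_End p S).
           conjugated (Fp_End p S) (Km p S \<sigma>) (Kr p S \<omega>))"
proof -
  let ?V = "Fp_End p S" and ?C = "spread_set S"
  interpret S: presemifield S by fact
  interpret d: presemifield "dual S" by (rule S.presemifield_dual)
  interpret sp: spread_space ?V ?C by (rule S.spread_space)
  have Nl: "Nl_cond p S = Nr_cond p (dual S)" "Nl p S = Nr p (dual S)"
    by (simp_all add: fun_eq_iff Nl_cond_def Nr_cond_def Nl_def Nr_def)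
  have left: "T\<lparr>carrier := left_nucleus T\<rparr> \<simeq> ?V\<lparr>carrier := Nl p S\<rparr>"
    if "semifield T" "isotopic p S T" for T :: "('b, 'n) ring_scheme"
  proof -
    have "dual (dual T) = T" by (simp add: dual_def)
    with dual_right_nucleus_iso[OF d.presemifield_axioms semifield.semifield_dual[OF that(1)]
        isotopic_dual[OF that(2)]]
    show ?thesis by (simp only: right_nucleus_dual Nl d.Nr_eq Fp_End_dual)
  qed
  have Km: "Km p S s = conj_by ?V s ` Kr p S s" if "s \<in> ?C" "s \<in> Units ?V" for s
    unfolding S.Km_eq[OF that(2)] S.Kr_eq[OF that(2)]
    by (rule sp.right_central_eq_conj_left_central[OF that])
  have center_m: "T\<lparr>carrier := semifield_center T\<rparr> \<simeq> ?V\<lparr>carrier := Km p S s\<rparr>"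
    if s: "s \<in> ?C" "s \<in> Units ?V" and T: "semifield T" "isotopic p S T"
    for s and T :: "('b, 'n) ring_scheme"
    unfolding Km[OF s]
  proof (rule ring_iso_trans)
    show "T\<lparr>carrier := semifield_center T\<rparr> \<simeq> ?V\<lparr>carrier := Kr p S s\<rparr>"
      unfolding S.Kr_eq[OF s(2)] by (rule center_iso[OF S.presemifield_axioms T s])
    show "?V\<lparr>carrier := Kr p S s\<rparr> \<simeq> ?V\<lparr>carrier := conj_by ?V s ` Kr p S s\<rparr>"
      unfolding S.Kr_eq[OF s(2)] by (rule sp.conj_by_iso[OF s(2) S.central_subset(1)])
  qed
  have conj: "conjugated ?V (Km p S s) (Kr p S w)"
    if w: "w \<in> ?C" "w \<in> Units ?V" and s: "s \<in> ?C" "s \<in> Units ?V" for w s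
  proof -
    have "Kr p S w = Kr p S s"
      unfolding S.Kr_eq[OF w(2)] S.Kr_eq[OF s(2)] by (rule sp.left_central_base_change[OF w s])
    also have "\<dots> = conj_by ?V (inv\<^bsub>?V\<^esub> s) ` Km p S s"
    proof -
      have "conj_by ?V (inv\<^bsub>?V\<^esub> s) (conj_by ?V s f) = f" if "f \<in> Kr p S s" for f
        using that s S.central_subset(1) by (intro sp.conj_by_inv) (auto simp: S.Kr_eq)
      then show ?thesis by (simp add: Km[OF s] image_image)
    qed
    finally show ?thesis
      unfolding conjugated_def conj_by_def using sp.Units_inv_Units[OF s(2)] by blast
  qed
  have right: "T\<lparr>carrier := right_nucleus T\<rparr> \<simeq> ?V\<lparr>carrier := Nr p S\<rparr>"
    if "semifield T" "isotopic p S T" for T :: "('b, 'n) ring_scheme"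
    unfolding S.Nr_eq by (rule right_nucleus_iso[OF S.presemifield_axioms that])
  have middle: "T\<lparr>carrier := middle_nucleus T\<rparr> \<simeq> ?V\<lparr>carrier := Nm p S\<rparr>"
    if "semifield T" "isotopic p S T" for T :: "('b, 'n) ring_scheme"
    unfolding S.Nm_eq by (rule middle_nucleus_iso[OF S.presemifield_axioms that])
  have center_r: "T\<lparr>carrier := semifield_center T\<rparr> \<simeq> ?V\<lparr>carrier := Kr p S w\<rparr>"
    if w: "w \<in> ?C" "w \<in> Units ?V" and T: "semifield T" "isotopic p S T"
    for w and T :: "('b, 'n) ring_scheme"
    unfolding S.Kr_eq[OF w(2)] by (rule center_iso[OF S.presemifield_axioms T w])
  have left_largest: "is_largest (Nl_cond p S) (Nl p S)" unfolding Nl by (rule d.Nr_largest)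
  show ?thesis
  proof (intro conjI allI ballI impI)
    show "is_largest (Nr_cond p S) (Nr p S)" by (rule S.Nr_largest)
    show "is_largest (Nm_cond p S) (Nm p S)" by (rule S.Nm_largest)
    show "is_largest (Nl_cond p S) (Nl p S)" by (rule left_largest)
    show "T\<lparr>carrier := right_nucleus T\<rparr> \<simeq> ?V\<lparr>carrier := Nr p S\<rparr>"
      if "semifield T \<and> isotopic p S T" for T :: "('b, 'n) ring_scheme"
      using that by (intro right) auto
    show "T\<lparr>carrier := middle_nucleus T\<rparr> \<simeq> ?V\<lparr>carrier := Nm p S\<rparr>"
      if "semifield T \<and> isotopic p S T" for T :: "('b, 'n) ring_scheme"
      using that by (intro middle) auto
    show "T\<lparr>carrier := left_nucleus T\<rparr> \<simeq> ?V\<lparr>carrier := Nl p S\<rparr>"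
      if "semifield T \<and> isotopic p S T" for T :: "('b, 'n) ring_scheme"
      using that by (intro left) auto
    show "is_largest (Kr_cond p S w) (Kr p S w)" if "w \<in> ?C \<inter> Units ?V" for w
      using that by (intro S.Kr_largest) auto
    show "T\<lparr>carrier := semifield_center T\<rparr> \<simeq> ?V\<lparr>carrier := Kr p S w\<rparr>"
      if "w \<in> ?C \<inter> Units ?V" "semifield T \<and> isotopic p S T" for w and T :: "('b, 'n) ring_scheme"
      using that by (intro center_r) auto
    show "is_largest (Km_cond p S s) (Km p S s)" if "s \<in> ?C \<inter> Units ?V" for s
      using that by (intro S.Km_largest) auto
    show "T\<lparr>carrier := semifield_center T\<rparr> \<simeq> ?V\<lparr>carrier := Km p S s\<rparr>"
      if "s \<in> ?C \<inter> Units ?V" "semifield T \<and> isotopic p S T" for s and T :: "('b, 'n) ring_scheme"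
      using that by (intro center_m) auto
    show "conjugated ?V (Km p S s) (Kr p S w)"
      if "w \<in> ?C \<inter> Units ?V" "s \<in> ?C \<inter> Units ?V" for w s
      using that by (intro conj) auto
  qed
qed

end
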